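(* Let $G$ be a connected ribbon graph and $A\subseteq E(G)$. Then (1) $G$ and $G^A$ are both plane if and only if $A$ defines a plane-join-biseparation of $G$; (2) $G$ and $G^A$ are both $\mathbb{R}\mathrm{P}^2$ if and only if $A$ defines an $\mathbb{R}\mathrm{P}^2$-join-biseparation of $G$.
   Context: A ribbon graph is a surface with boundary made of vertex discs and edge discs meeting in disjoint segments, each segment on the boundary of exactly one vertex and one edge, each edge containing exactly two segments; considered up to homeomorphism. Euler genus $\gamma$: twice the genus if orientable, non-orientable genus otherwise, summed over components. "Plane" (resp. "$\mathbb{R}\mathrm{P}^2$") ribbon graph: connected with $\gamma=0$ (resp. $\gamma=1$). Partial dual $G^A$ ($A\subseteq E(G)$): orient each edge boundary arbitrarily; the boundary components of the spanning ribbon subgraph $(V(G),A)$ meet the edges of $G$ in disjoint arcs; mark each such arc with an arrow in the direction of the edge's boundary orientation, labelled by the edge; $G^A$ is obtained by capping each marked boundary component with a vertex disc and, for each label $e$, attaching an edge disc along the two $e$-labelled arrows respecting directions. Edges of $G^A$ are identified with those of $G$. Join: for connected $G$ with non-trivial connected ribbon subgraphs $P,Q$, $G=P\cup Q$, $P\cap Q=\{v\}$, and an arc on the boundary of $v$ met by all edges of $P$ incident to $v$ and by no edges of $Q$, write $G=P\vee Q$. $H_1\vee\cdots\vee H_l$ means $(\cdots(H_1\vee H_2)\vee\cdots)\vee H_l$ (joins may occur at any vertices, not necessarily distinct). $A$ defines a join-biseparation of $G$ if $G=H_1\vee\cdots\vee H_l$ for some $l\ge1$ with $A=\bigcup_{i\in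 I}E(H_i)$ for some $I\subseteq\{1,\dots,l\}$; it is a plane-join-biseparation if moreover each $H_i$ is plane, and an $\mathbb{R}\mathrm{P}^2$-join-biseparation if exactly one $H_i$ is $\mathbb{R}\mathrm{P}^2$ and all others are plane. *)

theory Defs
  imports Complex_Main
begin

text \<open>
  Ribbon graphs are encoded by the standard combinatorial data that determine the surface up to
  homeomorphism. The discs of a ribbon graph meet in disjoint segments; a \<^emph>\<open>point\<close> is an end of
  such a segment, so that every edge carries four points. The boundary circles of the discs are cut
  at the points into arcs of three kinds, each giving a fixed-point free involution:
  \<^item> \<open>seg\<close> exchanges the two ends of a segment common to a vertex and an edge;
  \<^item> \<open>side\<close> exchanges the two ends of an arc on the boundary of an edge lying on no vertex;
  \<^item> \<open>arc\<close> exchanges the two ends of an arc on the boundary of a vertex lying on no edge.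

  A vertex without points is isolated.
\<close>

record ('v, 'e, 'p) ribbon_graph =
  verts :: "'v set"
  edges :: "'e set"
  pts :: "'p set"
  vert_of :: "'p \<Rightarrow> 'v"
  edge_of :: "'p \<Rightarrow> 'e"
  seg :: "'p \<Rightarrow> 'p"
  side :: "'p \<Rightarrow> 'p"
  arc :: "'p \<Rightarrow> 'p"

definition fpf_involution_on :: "'p set \<Rightarrow> ('p \<Rightarrow> 'p) \<Rightarrow> bool" where
  "fpf_involution_on X f \<longleftrightarrow> (\<forall>p\<in>X. f p \<in> X \<and> f p \<noteq> p \<and> f (f p) = p)"

definition orbit2 :: "('p \<Rightarrow> 'p) \<Rightarrow> ('p \<Rightarrow> 'p) \<Rightarrow> 'p \<Rightarrow> 'p set" where
  "orbit2 f g p = {(x, y). y = f x \<or> y = g x}\<^sup>* `` {p}"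

text \<open>
  The last two conditions say that the arcs on the boundary of an edge (of a vertex)
  form a single circle, i.e. that edges and vertices are discs.
\<close>

definition ribbon_graph :: "('v, 'e, 'p) ribbon_graph \<Rightarrow> bool" where
  "ribbon_graph G \<longleftrightarrow>
     finite (verts G) \<and> finite (edges G) \<and> finite (pts G) \<and>
     (\<forall>p\<in>pts G. vert_of G p \<in> verts G \<and> edge_of G p \<in> edges G) \<and>
     fpf_involution_on (pts G) (seg G) \<and>
     fpf_involution_on (pts G) (side G) \<and>
     fpf_involution_on (pts G) (arc G) \<and>
     (\<forall>e\<in>edges G. card {p \<in> pts G. edge_of G p = e} = 4) \<and>
     (\<forall>p\<in>pts G. orbit2 (seg G) (side G) p = {q \<in> pts G. edge_of G q = edge_of G p}) \<and>
     (\<forall>p\<in>pts G. orbit2 (seg G) (arc G) p = {q \<in> pts G. vert_of G q = vert_of G p})"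

definition adjacency :: "('v, 'e, 'p) ribbon_graph \<Rightarrow> ('v \<times> 'v) set" where
  "adjacency G = {(vert_of G p, vert_of G (side G p)) | p. p \<in> pts G}"

definition rg_connected :: "('v, 'e, 'p) ribbon_graph \<Rightarrow> bool" where
  "rg_connected G \<longleftrightarrow>
     verts G \<noteq> {} \<and> (\<forall>u\<in>verts G. \<forall>w\<in>verts G. (u, w) \<in> (adjacency G)\<^sup>*)"

text \<open>
  Walking along the boundary of a vertex, \<open>next_seg\<close> crosses a segment and
  the arc following it, arriving at the first point of the next segment.
\<close>

definition next_seg :: "('v, 'e, 'p) ribbon_graph \<Rightarrow> 'p \<Rightarrow> 'p" where
  "next_seg G p = arc G (seg G p)"

text \<open>
  The ribbon subgraph with vertex set \<open>V\<close> and edge set \<open>E\<close>. Once an edge is deleted, its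
  segments become part of the free boundary of the vertices, so an arc of the subgraph runs
  on until it reaches a segment of a remaining edge.
\<close>

definition subgraph_on ::
  "('v, 'e, 'p) ribbon_graph \<Rightarrow> 'v set \<Rightarrow> 'e set \<Rightarrow> ('v, 'e, 'p) ribbon_graph" where
  "subgraph_on G V E =
     \<lparr> verts = V, edges = E, pts = {p \<in> pts G. edge_of G p \<in> E},
       vert_of = vert_of G, edge_of = edge_of G, seg = seg G, side = side G,
       arc = (\<lambda>p. (next_seg G ^^ (LEAST n. edge_of G ((next_seg G ^^ n) (arc G p)) \<in> E))
                     (arc G p)) \<rparr>"

definition ribbon_subgraph ::
  "('v, 'e, 'p) ribbon_graph \<Rightarrow> ('v, 'e, 'p) ribbon_graph \<Rightarrow> bool" where
  "ribbon_subgraph H G \<longleftrightarrow>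
     verts H \<subseteq> verts G \<and> edges H \<subseteq> edges G \<and>
     (\<forall>p\<in>pts G. edge_of G p \<in> edges H \<longrightarrow> vert_of G p \<in> verts H) \<and>
     H = subgraph_on G (verts H) (edges H)"

definition components :: "('v, 'e, 'p) ribbon_graph \<Rightarrow> ('v, 'e, 'p) ribbon_graph set" where
  "components G =
     (\<lambda>V. subgraph_on G V {edge_of G p | p. p \<in> pts G \<and> vert_of G p \<in> V}) `
       (verts G // (adjacency G)\<^sup>*)"

text \<open>
  The boundary components of the spanning ribbon subgraph \<open>(V(G), A)\<close>. They meet an edge
  of \<open>G\<close> in its two sides if it is in \<open>A\<close>, and in its two segments otherwise; these are the
  \<open>marked\<close> arcs. A boundary component is represented by the set of points of \<open>G\<close> on
  it, or by the vertex it bounds if that vertex is isolated in \<open>G\<close>.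
\<close>

definition marked :: "('v, 'e, 'p) ribbon_graph \<Rightarrow> 'e set \<Rightarrow> 'p \<Rightarrow> 'p" where
  "marked G A p = (if edge_of G p \<in> A then side G p else seg G p)"

definition isolated :: "('v, 'e, 'p) ribbon_graph \<Rightarrow> 'v set" where
  "isolated G = verts G - vert_of G ` pts G"

definition boundary_components ::
  "('v, 'e, 'p) ribbon_graph \<Rightarrow> 'e set \<Rightarrow> ('p set + 'v) set" where
  "boundary_components G A =
     Inl ` orbit2 (marked G A) (arc G) ` pts G \<union> Inr ` isolated G"

text \<open>
  An orientation of the surface directs the boundary circles of the vertex discs; colour a point
  by whether its segment is directed away from it. Orientations of the vertices extend
  coherently to the edges iff every edge side joins points of different colours.
\<close>

definition orientable :: "('v, 'e, 'p) ribbon_graph \<Rightarrow> bool" where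
  "orientable G \<longleftrightarrow>
     (\<exists>c :: 'p \<Rightarrow> bool. \<forall>p\<in>pts G.
        c (seg G p) \<noteq> c p \<and> c (arc G p) \<noteq> c p \<and> c (side G p) \<noteq> c p)"

text \<open>
  The Euler characteristic of the closed surface obtained by capping all boundary components
  with discs.
\<close>

definition euler_char :: "('v, 'e, 'p) ribbon_graph \<Rightarrow> int" where
  "euler_char G =
     int (card (verts G)) - int (card (edges G)) + int (card (boundary_components G (edges G)))"

text \<open>
  For connected \<open>G\<close>: a closed orientable surface of genus \<open>g\<close> has Euler characteristic
  \<open>2 - 2 * g\<close>, a non-orientable one of genus \<open>g\<close> has Euler characteristic \<open>2 - g\<close>.
\<close>

definition genus :: "('v, 'e, 'p) ribbon_graph \<Rightarrow> rat" where
  "genus G = (if orientable G then (2 - of_int (euler_char G)) / 2 else 2 - of_int (euler_char G))"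

definition euler_genus :: "('v, 'e, 'p) ribbon_graph \<Rightarrow> rat" where
  "euler_genus G = (\<Sum>C\<in>components G. if orientable C then 2 * genus C else genus C)"

definition plane :: "('v, 'e, 'p) ribbon_graph \<Rightarrow> bool" where
  "plane G \<longleftrightarrow> rg_connected G \<and> euler_genus G = 0"

definition RP2 :: "('v, 'e, 'p) ribbon_graph \<Rightarrow> bool" where
  "RP2 G \<longleftrightarrow> rg_connected G \<and> euler_genus G = 1"

text \<open>
  The vertices of the partial dual cap the boundary components of \<open>(V(G), A)\<close>, so their
  boundary circles consist of the marked arcs, which become the segments of the dual, and the
  old arcs, which remain. The edge discs are reattached along the marked arcs: if the boundary of
  an edge, in the chosen orientation, runs through points \<open>a, b, c, d\<close> and the marked arcs (arrows)
  are \<open>a \<rightarrow> b\<close> and \<open>c \<rightarrow> d\<close>, then a disc attached along these arrows has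
  the sides \<open>b c\<close> and \<open>d a\<close>, which are the two unmarked arcs of that edge. This does not
  depend on the orientation chosen.
\<close>

definition partial_dual ::
  "('v, 'e, 'p) ribbon_graph \<Rightarrow> 'e set \<Rightarrow> ('p set + 'v, 'e, 'p) ribbon_graph" where
  "partial_dual G A =
     \<lparr> verts = boundary_components G A, edges = edges G, pts = pts G,
       vert_of = (\<lambda>p. Inl (orbit2 (marked G A) (arc G) p)), edge_of = edge_of G,
       seg = marked G A,
       side = (\<lambda>p. if edge_of G p \<in> A then seg G p else side G p),
       arc = arc G \<rparr>"

text \<open>
  An arc on the boundary of a vertex, up to the segments it meets, is given by its first point \<open>p\<close>
  and the number \<open>n\<close> of consecutive segments it runs through; \<open>arc_pts\<close> are the ends of these.
\<close>

definition arc_pts :: "('v, 'e, 'p) ribbon_graph \<Rightarrow> 'p \<Rightarrow> nat \<Rightarrow> 'p set" where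
  "arc_pts G p n = (\<Union>i<n. {(next_seg G ^^ i) p, seg G ((next_seg G ^^ i) p)})"

text \<open>
  In a join, the arc on \<open>v\<close> has to meet the edges of \<open>P\<close> in \<^emph>\<open>all\<close> their segments at \<open>v\<close>:
  a loop of \<open>P\<close> at \<open>v\<close> has both its segments on the arc.
\<close>

definition is_join ::
  "('v, 'e, 'p) ribbon_graph \<Rightarrow> ('v, 'e, 'p) ribbon_graph \<Rightarrow> ('v, 'e, 'p) ribbon_graph \<Rightarrow> bool" where
  "is_join G P Q \<longleftrightarrow>
     rg_connected G \<and>
     ribbon_subgraph P G \<and> rg_connected P \<and> edges P \<noteq> {} \<and>
     ribbon_subgraph Q G \<and> rg_connected Q \<and> edges Q \<noteq> {} \<and>
     verts G = verts P \<union> verts Q \<and> edges G = edges P \<union> edges Q \<and>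
     (\<exists>v. verts P \<inter> verts Q = {v} \<and> edges P \<inter> edges Q = {} \<and>
        (\<exists>p\<in>pts G. \<exists>n. vert_of G p = v \<and>
           (\<forall>q\<in>pts G. vert_of G q = v \<longrightarrow>
              (edge_of G q \<in> edges P \<longrightarrow> q \<in> arc_pts G p n) \<and>
              (edge_of G q \<in> edges Q \<longrightarrow> q \<notin> arc_pts G p n))))"

text \<open>\<open>is_iterated_join G [H\<^sub>1, ..., H\<^sub>l]\<close> is the left-nested iterated join of the \<open>H\<^sub>i\<close>.\<close>

inductive is_iterated_join ::
  "('v, 'e, 'p) ribbon_graph \<Rightarrow> ('v, 'e, 'p) ribbon_graph list \<Rightarrow> bool" where
  single: "is_iterated_join G [G]"
| snoc: "is_iterated_join P Hs \<Longrightarrow> is_join G P Q \<Longrightarrow> is_iterated_join G (Hs @ [Q])"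

definition join_biseparation ::
  "('v, 'e, 'p) ribbon_graph \<Rightarrow> 'e set \<Rightarrow> ('v, 'e, 'p) ribbon_graph list \<Rightarrow> bool" where
  "join_biseparation G A Hs \<longleftrightarrow>
     is_iterated_join G Hs \<and> (\<exists>I\<subseteq>{..<length Hs}. A = (\<Union>i\<in>I. edges (Hs ! i)))"

definition plane_join_biseparation :: "('v, 'e, 'p) ribbon_graph \<Rightarrow> 'e set \<Rightarrow> bool" where
  "plane_join_biseparation G A \<longleftrightarrow>
     (\<exists>Hs. join_biseparation G A Hs \<and> (\<forall>i<length Hs. plane (Hs ! i)))"

definition RP2_join_biseparation :: "('v, 'e, 'p) ribbon_graph \<Rightarrow> 'e set \<Rightarrow> bool" where
  "RP2_join_biseparation G A \<longleftrightarrow>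
     (\<exists>Hs. join_biseparation G A Hs \<and>
        (\<exists>i<length Hs. RP2 (Hs ! i) \<and> (\<forall>j<length Hs. j \<noteq> i \<longrightarrow> plane (Hs ! j))))"

end

theory Submission
  imports Defs
begin

text \<open>
  Orientability plays no role: for connected \<open>G\<close> the Euler genus is \<open>2 - \<chi>(G)\<close>, and with \<open>f(B)\<close> the
  number of boundary components of \<open>(V(G), B)\<close> the Euler genus of \<open>G\<^sup>A\<close> is
  \<open>\<gamma>(A) = 2 + |E| - f(A) - f(E - A)\<close>. A set \<open>Q\<close> of edges splits off as a join iff exactly two
  arcs lead from segments of \<open>Q\<close> to segments of other edges; the circles crossing from \<open>Q\<close> to \<open>E - Q\<close>
  then form a single one, so \<open>f\<close>, and with it \<open>\<gamma>\<close>, behaves additively. This gives one direction.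

  For the other, choose \<open>T\<close> with \<open>f(T) = 1\<close>, so that \<open>G\<^sup>T\<close> has a single vertex. The function
  \<open>\<rho>(S) = |S| + 1 - f(T \<triangle> S)\<close> is monotone (it is the rank of a block of the interlace matrix of
  \<open>G\<^sup>T\<close>), and \<open>\<gamma>(\<emptyset>) = \<rho>(T) + \<rho>(E - T)\<close>, \<open>\<gamma>(A) = \<rho>(T') + \<rho>(E - T')\<close> with \<open>T' = T \<triangle> A\<close>. If both
  are at most \<open>1\<close>, two interlaced loops of \<open>G\<^sup>T\<close> lie on the same side of \<open>T\<close> iff both are twisted,
  and likewise for \<open>T'\<close>; hence no loop in \<open>A\<close> is interlaced with one outside \<open>A\<close>. So around the
  vertex of \<open>G\<^sup>T\<close> some maximal run of loops of one colour is closed, i.e. contains both ends of all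
  its loops. This run has only two arcs to other loops, a property that does not
  change under partial duality, so it splits off from \<open>G\<close>, and one proceeds by induction.
\<close>

subsection \<open>Counting classes of a relation\<close>

definition links :: "'a set \<Rightarrow> ('a \<Rightarrow> 'a) \<Rightarrow> ('a \<times> 'a) set" where
  "links Z f = {(x, f x) | x. x \<in> Z}"

text \<open>For symmetric \<open>R\<close> this is the number of components meeting
  \<open>X\<close>; \<open>R\<^sup>*\<close> alone is only a preorder, so symmetry accompanies most
  lemmas below.\<close>

definition num_classes :: "'a set \<Rightarrow> ('a \<times> 'a) set \<Rightarrow> nat" where
  "num_classes X R = card ((\<lambda>x. R\<^sup>* `` {x}) ` X)"

lemma links_iff: "(x, y) \<in> links Z f \<longleftrightarrow> x \<in> Z \<and> y = f x"
  by (auto simp: links_def)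

lemma sym_links: "fpf_involution_on Z f \<Longrightarrow> sym (links Z f)"
  by (auto simp: sym_def links_iff fpf_involution_on_def)

lemma links_subset: "fpf_involution_on Z f \<Longrightarrow> Z \<subseteq> X \<Longrightarrow> links Z f \<subseteq> X \<times> X"
  by (auto simp: links_def fpf_involution_on_def)

lemma sym_insert_pair: "sym R \<Longrightarrow> sym (R \<union> {(a, b), (b, a)})"
  by (auto simp: sym_def)

lemma class_eq:
  assumes "sym R" "(x, y) \<in> R\<^sup>*" shows "R\<^sup>* `` {x} = R\<^sup>* `` {y}"
proof -
  have "(y, x) \<in> R\<^sup>*" using assms by (meson sym_rtrancl symE)
  then show ?thesis using assms(2) by (auto intro: rtrancl_trans)
qed

lemma class_subset: "x \<in> C \<Longrightarrow> R `` C \<subseteq> C \<Longrightarrow> R\<^sup>* `` {x} \<subseteq> C"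
  by (metis Image_closed_trancl Image_mono empty_subsetI insert_subset order_refl)

lemma num_classes_cong: "R\<^sup>* = S\<^sup>* \<Longrightarrow> num_classes X R = num_classes X S"
  by (simp add: num_classes_def)

lemma num_classes_redundant:
  assumes "sym R" "(a, b) \<in> R\<^sup>*"
  shows "num_classes X (R \<union> {(a, b), (b, a)}) = num_classes X R"
proof -
  have "(b, a) \<in> R\<^sup>*" using assms by (meson sym_rtrancl symE)
  then have "(R \<union> {(a, b), (b, a)})\<^sup>* = R\<^sup>*" using assms by (intro rtrancl_subset) auto
  then show ?thesis by (rule num_classes_cong)
qed

text \<open>The classes of \<open>a\<close> and \<open>b\<close> fuse into one and all other classes
  stay as they are.\<close>

lemma num_classes_merge:
  assumes "finite X" "sym R" "a \<in> X" "b \<in> X" and ab: "(a, b) \<notin> R\<^sup>*"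
  shows "num_classes X (R \<union> {(a, b), (b, a)}) + 1 = num_classes X R"
proof -
  let ?S = "R \<union> {(a, b), (b, a)}" and ?k = "\<lambda>x. R\<^sup>* `` {x}"
  let ?C = "?k a \<union> ?k b"
  have symS: "sym ?S" using assms(2) by (rule sym_insert_pair)
  have eq: "?k x = ?k y" if "y \<in> ?k x" for x y
    using class_eq[OF assms(2)] that by blast
  have RS: "R\<^sup>* \<subseteq> ?S\<^sup>*" by (rule rtrancl_mono) auto
  have abS: "(a, b) \<in> ?S\<^sup>*" by auto
  have C: "?S\<^sup>* `` {x} = ?C" if "x \<in> ?C" for x
  proof
    show "?S\<^sup>* `` {x} \<subseteq> ?C"
      by (rule class_subset[OF that]) (auto intro: rtrancl_into_rtrancl)
    have "(a, x) \<in> ?S\<^sup>*" using that RS abS by (auto intro: rtrancl_trans)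
    then have "?S\<^sup>* `` {x} = ?S\<^sup>* `` {a}" using class_eq[OF symS] by blast
    then show "?C \<subseteq> ?S\<^sup>* `` {x}" using RS abS by (auto intro: rtrancl_trans)
  qed
  have nC: "?S\<^sup>* `` {x} = ?k x" if "x \<notin> ?C" for x
  proof
    have "a \<notin> ?k x" "b \<notin> ?k x" using that eq[of a x] eq[of b x] by auto
    then show "?S\<^sup>* `` {x} \<subseteq> ?k x"
      by (intro class_subset) (auto intro: rtrancl_into_rtrancl)
    show "?k x \<subseteq> ?S\<^sup>* `` {x}" using RS by auto
  qed
  have ne: "?k a \<noteq> ?k b" using ab by auto
  have img: "(\<lambda>x. ?S\<^sup>* `` {x}) ` X = insert ?C (?k ` X - {?k a, ?k b})" (is "?l = ?r")
  proof (intro equalityI subsetI)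
    fix D assume "D \<in> ?l"
    then obtain x where x: "x \<in> X" "D = ?S\<^sup>* `` {x}" by blast
    show "D \<in> ?r"
    proof (cases "x \<in> ?C")
      case True then show ?thesis using C x(2) by simp
    next
      case False
      have "x \<in> ?k x" by blast
      then have "?k x \<noteq> ?k a" "?k x \<noteq> ?k b" using False by blast+
      then show ?thesis using nC[OF False] x by simp
    qed
  next
    fix D assume "D \<in> ?r"
    then consider "D = ?C" | x where "x \<in> X" "D = ?k x" "?k x \<noteq> ?k a" "?k x \<noteq> ?k b" by blast
    then show "D \<in> ?l"
    proof cases
      case 1
      have "a \<in> ?C" by blast
      from C[OF this] 1 \<open>a \<in> X\<close> show ?thesis by blast
    next
      case 2
      have "x \<notin> ?C" using 2(3,4) eq by blast
      from nC[OF this] 2 show ?thesis by blast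
    qed
  qed
  have nin: "?C \<notin> ?k ` X - {?k a, ?k b}"
  proof
    assume h: "?C \<in> ?k ` X - {?k a, ?k b}"
    then obtain x where "?C = ?k x" by auto
    then have "a \<in> ?k x" by auto
    then have "?k x = ?k a" using eq by blast
    then show False using h \<open>?C = ?k x\<close> by auto
  qed
  have fin: "finite (?k ` X)" using assms(1) by simp
  have c2: "card {?k a, ?k b} = 2" using ne by simp
  have sub: "{?k a, ?k b} \<subseteq> ?k ` X" using assms by auto
  have "card (?k ` X - {?k a, ?k b}) = card (?k ` X) - 2"
    using sub c2 by (simp add: card_Diff_subset)
  moreover have "2 \<le> card (?k ` X)" using card_mono[OF fin sub] c2 by simp
  ultimately show ?thesis unfolding num_classes_def img using nin fin by simp
qed

lemma num_classes_add:
  assumes "finite X" "sym R" "a \<in> X" "b \<in> X"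
  shows "num_classes X (R \<union> {(a, b), (b, a)}) \<le> num_classes X R"
    and "num_classes X R \<le> num_classes X (R \<union> {(a, b), (b, a)}) + 1"
  using num_classes_merge[OF assms] num_classes_redundant[OF assms(2), of a b X] by linarith+

text \<open>Both relations become the same after adding one more of the four pairs.\<close>

lemma num_classes_switch_le:
  assumes "finite X" "sym R" "a \<in> X" "b \<in> X" "c \<in> X" "d \<in> X"
  shows "num_classes X (R \<union> {(a, c), (c, a)} \<union> {(b, d), (d, b)})
    \<le> num_classes X (R \<union> {(a, b), (b, a)} \<union> {(c, d), (d, c)}) + 1"
proof -
  let ?S = "R \<union> {(a, c), (c, a)} \<union> {(b, d), (d, b)}"
  let ?T = "R \<union> {(a, b), (b, a)} \<union> {(c, d), (d, c)}"
  have S: "sym ?S" and T: "sym ?T" using assms(2) by (intro sym_insert_pair, assumption)+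
  let ?S' = "?S \<union> {(a, b), (b, a)}"
  have "(c, d) \<in> ?S'\<^sup>*"
  proof -
    have "(c, a) \<in> ?S'" "(a, b) \<in> ?S'" "(b, d) \<in> ?S'" by auto
    then show ?thesis by (meson r_into_rtrancl rtrancl_trans)
  qed
  then have 1: "num_classes X (?S' \<union> {(c, d), (d, c)}) = num_classes X ?S'"
    by (intro num_classes_redundant sym_insert_pair S)
  have "num_classes X (?S' \<union> {(c, d), (d, c)})
      = num_classes X (?T \<union> {(a, c), (c, a)} \<union> {(b, d), (d, b)})"
    by (rule arg_cong[where f = "num_classes X"]) auto
  also have "\<dots> \<le> num_classes X (?T \<union> {(a, c), (c, a)})"
    by (intro num_classes_add assms sym_insert_pair T)
  also have "\<dots> \<le> num_classes X ?T"
    by (intro num_classes_add assms T)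
  finally show ?thesis using 1 num_classes_add(2)[OF assms(1) S assms(3,4)] by linarith
qed

text \<open>Here the pairs \<open>(a, b)\<close> and \<open>(c, d)\<close> are redundant. Of the
  other two, the first fuses two classes and the second is redundant after it, so exactly one class
  is lost. In the applications \<open>R\<close> traces boundary circles with two links
  removed.\<close>

lemma num_classes_switch_eq:
  assumes "finite X" "sym R" "a \<in> X" "b \<in> X" "c \<in> X" "d \<in> X"
    and ab: "(a, b) \<in> R\<^sup>*" and cd: "(c, d) \<in> R\<^sup>*" and ac: "(a, c) \<notin> R\<^sup>*"
  shows "num_classes X (R \<union> {(a, c), (c, a)} \<union> {(b, d), (d, b)}) + 1
    = num_classes X (R \<union> {(a, b), (b, a)} \<union> {(c, d), (d, c)})"
proof -
  let ?S = "R \<union> {(a, c), (c, a)}"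
  have RS: "R\<^sup>* \<subseteq> ?S\<^sup>*" by (rule rtrancl_mono) auto
  have "(b, a) \<in> ?S\<^sup>*" using ab assms(2) RS by (meson subsetD sym_rtrancl symE)
  moreover have "(a, c) \<in> ?S\<^sup>*" "(c, d) \<in> ?S\<^sup>*" using cd RS by auto
  ultimately have "(b, d) \<in> ?S\<^sup>*" by (meson rtrancl_trans)
  then have "num_classes X (?S \<union> {(b, d), (d, b)}) = num_classes X ?S"
    by (intro num_classes_redundant sym_insert_pair assms)
  moreover have "num_classes X ?S + 1 = num_classes X R"
    by (intro num_classes_merge assms)
  moreover have "num_classes X (R \<union> {(a, b), (b, a)} \<union> {(c, d), (d, c)})
      = num_classes X (R \<union> {(a, b), (b, a)})"
  proof (intro num_classes_redundant sym_insert_pair assms)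
    show "(c, d) \<in> (R \<union> {(a, b), (b, a)})\<^sup>*"
      using cd rtrancl_mono[of R "R \<union> {(a, b), (b, a)}"] by auto
  qed
  moreover have "num_classes X (R \<union> {(a, b), (b, a)}) = num_classes X R"
    by (intro num_classes_redundant assms)
  ultimately show ?thesis by linarith
qed

lemma num_classes_Un:
  assumes "finite X" "finite Y" "X \<inter> Y = {}" "R \<subseteq> X \<times> X" "S \<subseteq> Y \<times> Y"
  shows "num_classes (X \<union> Y) (R \<union> S) = num_classes X R + num_classes Y S"
proof -
  have *: "(R \<union> S)\<^sup>* `` {x} = R\<^sup>* `` {x} \<and> R\<^sup>* `` {x} \<subseteq> X"
    if "x \<in> X" "X \<inter> Y = {}" "R \<subseteq> X \<times> X" "S \<subseteq> Y \<times> Y" for x and X Y :: "'a set" and R S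
  proof -
    have X: "R\<^sup>* `` {x} \<subseteq> X" using that by (intro class_subset) auto
    have "(R \<union> S)\<^sup>* `` {x} \<subseteq> R\<^sup>* `` {x}"
      using X that by (intro class_subset) (auto intro: rtrancl_into_rtrancl)
    moreover have "R\<^sup>* \<subseteq> (R \<union> S)\<^sup>*" by (rule rtrancl_mono) auto
    ultimately show ?thesis using X by auto
  qed
  have 1: "(R \<union> S)\<^sup>* `` {x} = R\<^sup>* `` {x} \<and> R\<^sup>* `` {x} \<subseteq> X" if "x \<in> X" for x
    using *[OF that assms(3-5)] .
  have 2: "(R \<union> S)\<^sup>* `` {x} = S\<^sup>* `` {x} \<and> S\<^sup>* `` {x} \<subseteq> Y" if "x \<in> Y" for x
    using *[OF that _ assms(5) assms(4)] assms(3) by (simp add: Un_commute Int_commute)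
  have i: "(\<lambda>x. (R \<union> S)\<^sup>* `` {x}) ` (X \<union> Y)
      = (\<lambda>x. R\<^sup>* `` {x}) ` X \<union> (\<lambda>x. S\<^sup>* `` {x}) ` Y"
    using 1 2 by (simp add: image_Un)
  have "(\<lambda>x. R\<^sup>* `` {x}) ` X \<inter> (\<lambda>x. S\<^sup>* `` {x}) ` Y = {}"
  proof (rule ccontr)
    assume "\<not> ?thesis"
    then obtain x y where "x \<in> X" "y \<in> Y" "R\<^sup>* `` {x} = S\<^sup>* `` {y}" by auto
    then have "x \<in> Y" using 2 by blast
    then show False using \<open>x \<in> X\<close> assms(3) by blast
  qed
  then show ?thesis unfolding num_classes_def i using assms by (intro card_Un_disjoint) auto
qed

lemma num_classes_eq_1_iff:
  assumes "sym R"
  shows "num_classes X R = 1 \<longleftrightarrow> X \<noteq> {} \<and> (\<forall>x\<in>X. \<forall>y\<in>X. (x, y) \<in> R\<^sup>*)"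
proof
  assume "num_classes X R = 1"
  then obtain D where D: "(\<lambda>x. R\<^sup>* `` {x}) ` X = {D}"
    unfolding num_classes_def by (metis One_nat_def card_1_singletonE)
  have "(x, y) \<in> R\<^sup>*" if "x \<in> X" "y \<in> X" for x y
  proof -
    have "R\<^sup>* `` {x} \<in> {D}" "R\<^sup>* `` {y} \<in> {D}"
      using that unfolding D[symmetric] by (auto intro!: imageI)
    then have "R\<^sup>* `` {x} = R\<^sup>* `` {y}" by simp
    then show ?thesis by blast
  qed
  then show "X \<noteq> {} \<and> (\<forall>x\<in>X. \<forall>y\<in>X. (x, y) \<in> R\<^sup>*)" using D by auto
next
  assume *: "X \<noteq> {} \<and> (\<forall>x\<in>X. \<forall>y\<in>X. (x, y) \<in> R\<^sup>*)"
  then obtain a where "a \<in> X" by auto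
  have "R\<^sup>* `` {x} = R\<^sup>* `` {a}" if "x \<in> X" for x
    using * class_eq[OF assms] that \<open>a \<in> X\<close> by (metis (no_types, lifting))
  then have "(\<lambda>x. R\<^sup>* `` {x}) ` X = (\<lambda>x. R\<^sup>* `` {a}) ` X" by (intro image_cong refl)
  also have "\<dots> = {R\<^sup>* `` {a}}" using * by blast
  finally have "(\<lambda>x. R\<^sup>* `` {x}) ` X = {R\<^sup>* `` {a}}" .
  then show "num_classes X R = 1" unfolding num_classes_def by simp
qed

lemma num_classes_pos: "finite X \<Longrightarrow> X \<noteq> {} \<Longrightarrow> num_classes X R \<ge> 1"
  by (simp add: num_classes_def Suc_leI card_gt_0_iff)

section \<open>Paths formed by two involutions\<close>

lemma even_card_involution:
  assumes "finite X" "fpf_involution_on X f" shows "even (card X)"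
  using assms
proof (induction "card X" arbitrary: X rule: less_induct)
  case less
  show ?case
  proof (cases "X = {}")
    case False
    then obtain x where x: "x \<in> X" by auto
    have f: "f x \<in> X" "f x \<noteq> x" "f (f x) = x" using less.prems(2) x by (auto simp: fpf_involution_on_def)
    let ?Y = "X - {x, f x}"
    have c: "card X = card ?Y + 2"
    proof -
      have "card ?Y = card X - card {x, f x}" using x f less.prems by (intro card_Diff_subset) auto
      moreover have "card {x, f x} \<le> card X" using x f less.prems by (intro card_mono) auto
      ultimately show ?thesis using f by (simp add: eq_commute)
    qed
    have "fpf_involution_on ?Y f" unfolding fpf_involution_on_def
    proof (intro ballI conjI)
      fix p assume p: "p \<in> ?Y"
      then have q: "f p \<in> X" "f p \<noteq> p" "f (f p) = p" using less.prems(2) by (auto simp: fpf_involution_on_def)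
      then show "f p \<in> ?Y" "f p \<noteq> p" "f (f p) = p" using p f by auto
    qed
    then have "even (card ?Y)" using less.hyps[of ?Y] less.prems c by auto
    then show ?thesis using c by simp
  qed auto
qed

text \<open>The relation is a graph of maximum degree two in which exactly the points of \<open>Z\<close> have
  degree one, so the component of such a point is a path.\<close>

lemma path_ends:
  assumes fin: "finite X" and f: "fpf_involution_on X f" and g: "fpf_involution_on (X - Z) g"
    and "Z \<subseteq> X" "z \<in> Z"
  shows "\<exists>z'. z' \<noteq> z \<and> (links X f \<union> links (X - Z) g)\<^sup>* `` {z} \<inter> Z = {z, z'}"
proof -
  let ?R = "links X f \<union> links (X - Z) g"
  have F: "f x \<in> X" "f x \<noteq> x" "f (f x) = x" if "x \<in> X" for x
    using f that by (auto simp: fpf_involution_on_def)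
  have G: "g x \<in> X" "g x \<notin> Z" "g x \<noteq> x" "g (g x) = x" if "x \<in> X" "x \<notin> Z" for x
    using g that by (auto simp: fpf_involution_on_def)
  \<comment> \<open>The walk from \<open>z\<close> alternates between \<open>f\<close> and
    \<open>g\<close>; it stops at the first \<open>f (w k)\<close> in \<open>Z\<close>, where no
    link of \<open>g\<close> leads on.\<close>
  define w where "w i = ((g \<circ> f) ^^ i) z" for i
  have w0: "w 0 = z" and wS: "w (Suc i) = g (f (w i))" for i by (simp_all add: w_def)
  have "z \<in> X" using assms by auto
  have step: "w (Suc i) \<in> X - Z" if "w i \<in> X" "f (w i) \<notin> Z" for i
    using that F G wS by auto
  have "\<exists>k. f (w k) \<in> Z"
  proof (rule ccontr)
    assume no: "\<not> ?thesis"
    have wX: "w i \<in> X" for i by (induction i) (use w0 \<open>z \<in> X\<close> step no in auto)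
    have "w i \<noteq> w j" if "i < j" for i j
      using that
    proof (induction i arbitrary: j)
      case 0
      then obtain j' where "j = Suc j'" using gr0_conv_Suc by auto
      then have "w j \<notin> Z" using step wX no by auto
      then show ?case using w0 \<open>z \<in> Z\<close> by auto
    next
      case (Suc i)
      then obtain j' where j': "j = Suc j'" "i < j'" by (metis Suc_lessE)
      \<comment> \<open>Cancelling \<open>g\<close> and \<open>f\<close> moves an equality of two
        positions back to the start, which lies in \<open>Z\<close> while all later positions avoid
        \<open>Z\<close>.\<close>
      have "w i = w j'" if "w (Suc i) = w j"
        using that wS wX no F G j'(1) by metis
      then show ?case using Suc.IH j' by auto
    qed
    then have "inj w" by (metis injI linorder_neqE_nat)
    moreover have "range w \<subseteq> X" using wX by auto
    ultimately show False using fin by (meson finite_imageD finite_subset infinite_UNIV_nat)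
  qed
  then obtain k where k: "f (w k) \<in> Z" and "\<forall>i<k. f (w i) \<notin> Z"
    using exists_least_iff[where P = "\<lambda>k. f (w k) \<in> Z"] by auto
  then have min: "f (w i) \<notin> Z" if "i < k" for i using that by blast
  have wX: "w i \<in> X \<and> (i > 0 \<longrightarrow> w i \<notin> Z)" if "i \<le> k" for i
    using that
  proof (induction i)
    case (Suc i) then show ?case using step[of i] min[of i] by auto
  qed (use w0 \<open>z \<in> X\<close> in auto)
  let ?D = "(\<Union>i\<le>k. {w i, f (w i)})"
  let ?C = "?R\<^sup>* `` {z}"
  have "?C \<subseteq> ?D"
  proof (rule class_subset)
    show "z \<in> ?D" using w0 by force
    show "?R `` ?D \<subseteq> ?D"
    proof
      fix y assume "y \<in> ?R `` ?D"
      then obtain x where x: "x \<in> ?D" "(x, y) \<in> ?R" by auto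
      then obtain i where i: "i \<le> k" "x = w i \<or> x = f (w i)" by auto
      from x(2) consider "y = f x" | "x \<notin> Z" "y = g x" by (auto simp: links_iff)
      then show "y \<in> ?D"
      proof cases
        case 1 then show ?thesis using i wX[of i] F[of "w i"] by (intro UN_I[of i]) auto
      next
        case 2
        show ?thesis using i(2)
        proof
          assume x: "x = w i"
          then obtain j where j: "i = Suc j" using 2 w0 \<open>z \<in> Z\<close> by (cases i) auto
          then have "w j \<in> X" "f (w j) \<notin> Z" using wX[of j] min[of j] i by auto
          then have "y = f (w j)" using 2 x j wS G F by auto
          then show ?thesis using j i by (intro UN_I[of j]) auto
        next
          assume x: "x = f (w i)"
          then have "i \<noteq> k" using 2 k by auto
          then show ?thesis using i x 2 wS[of i] by (intro UN_I[of "Suc i"]) auto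
        qed
      qed
    qed
  qed
  moreover have "?D \<inter> Z \<subseteq> {z, f (w k)}"
  proof
    fix y assume y: "y \<in> ?D \<inter> Z"
    then obtain i where i: "i \<le> k" "y = w i \<or> y = f (w i)" by auto
    show "y \<in> {z, f (w k)}" using i(2)
    proof
      assume "y = w i" then show ?thesis using y wX[OF i(1)] w0 by (cases "i = 0") auto
    next
      assume "y = f (w i)" then show ?thesis using y min[of i] i(1) by (cases "i = k") auto
    qed
  qed
  ultimately have sub: "?C \<inter> Z \<subseteq> {z, f (w k)}" by blast
  have CX: "?C \<subseteq> X" using \<open>z \<in> X\<close> F(1) G(1) by (intro class_subset) (auto simp: links_iff)
  then have finC: "finite ?C" using fin finite_subset by blast
  have "?R `` ?C \<subseteq> ?C" by (auto intro: rtrancl_into_rtrancl)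
  then have Cf: "f x \<in> ?C" and Cg: "x \<notin> Z \<Longrightarrow> g x \<in> ?C" if "x \<in> ?C" for x
    using that CX by (auto simp: links_iff Image_def simp del: Image_singleton_iff)
  \<comment> \<open>Parity: \<open>f\<close> pairs up the whole component and \<open>g\<close> pairs
    up its part outside \<open>Z\<close>, so the component meets \<open>Z\<close> in an even number
    of points and \<open>z\<close> is not alone there.\<close>
  have "fpf_involution_on ?C f"
    unfolding fpf_involution_on_def using CX F Cf by blast
  then have "even (card ?C)" using even_card_involution finC by blast
  moreover have "fpf_involution_on (?C - Z) g"
    unfolding fpf_involution_on_def using CX G Cg by blast
  then have "even (card (?C - Z))" using even_card_involution finC by blast
  moreover have "card ?C = card (?C \<inter> Z) + card (?C - Z)"
    using finC by (metis card_Int_Diff)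
  ultimately have ev: "even (card (?C \<inter> Z))" by simp
  have "z \<in> ?C \<inter> Z" using \<open>z \<in> Z\<close> by auto
  have "\<not> ?C \<inter> Z \<subseteq> {z}"
  proof
    assume "?C \<inter> Z \<subseteq> {z}"
    then have "?C \<inter> Z = {z}" using \<open>z \<in> ?C \<inter> Z\<close> by auto
    then show False using ev by simp
  qed
  then have "f (w k) \<noteq> z \<and> ?C \<inter> Z = {z, f (w k)}" using sub \<open>z \<in> ?C \<inter> Z\<close> by blast
  then show ?thesis by blast
qed

subsection \<open>Points with three involutions\<close>

text \<open>
  The points and their three involutions: \<open>m\<close> joins the points along the vertices, \<open>u\<close> along the
  free sides of the edges and \<open>r\<close> along the free arcs. A partial dual exchanges \<open>m\<close> and \<open>u\<close> on
  some edges.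
\<close>

locale point_map =
  fixes X :: "'p set" and m u r :: "'p \<Rightarrow> 'p" and ed :: "'p \<Rightarrow> 'e"
  assumes fin: "finite X"
    and m: "fpf_involution_on X m" and u: "fpf_involution_on X u" and r: "fpf_involution_on X r"
    and ed_m: "p \<in> X \<Longrightarrow> ed (m p) = ed p" and ed_u: "p \<in> X \<Longrightarrow> ed (u p) = ed p"
    and mu: "p \<in> X \<Longrightarrow> m (u p) = u (m p)"
    and mu_ne: "p \<in> X \<Longrightarrow> m (u p) \<noteq> p"
    and ed_eq: "p \<in> X \<Longrightarrow> q \<in> X \<Longrightarrow> ed q = ed p \<Longrightarrow> q \<in> {p, m p, u p, m (u p)}"
begin

lemma mD: "p \<in> X \<Longrightarrow> m p \<in> X" "p \<in> X \<Longrightarrow> m p \<noteq> p" "p \<in> X \<Longrightarrow> m (m p) = p"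
  and uD: "p \<in> X \<Longrightarrow> u p \<in> X" "p \<in> X \<Longrightarrow> u p \<noteq> p" "p \<in> X \<Longrightarrow> u (u p) = p"
  and rD: "p \<in> X \<Longrightarrow> r p \<in> X" "p \<in> X \<Longrightarrow> r p \<noteq> p" "p \<in> X \<Longrightarrow> r (r p) = p"
  using m u r by (auto simp: fpf_involution_on_def)

lemma mu_ne': "p \<in> X \<Longrightarrow> m p \<noteq> u p" "p \<in> X \<Longrightarrow> u p \<noteq> m p"
  using mu_ne mD by metis+

text \<open>For ribbon graphs these are the segments of the partial dual at \<open>S\<close>, while
  \<open>mk (- S)\<close> gives its free sides.\<close>

definition mk :: "'e set \<Rightarrow> 'p \<Rightarrow> 'p" where
  "mk S p = (if ed p \<in> S then u p else m p)"

lemma mk_empty: "mk {} = m"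
  by (auto simp: mk_def)

lemma mk_inv: "fpf_involution_on X (mk S)"
  using m u ed_m ed_u by (auto simp: fpf_involution_on_def mk_def)

definition rel :: "'e set \<Rightarrow> ('p \<times> 'p) set" where
  "rel S = links X r \<union> links X (mk S)"

text \<open>The boundary components of the spanning ribbon subgraph with edges \<open>S\<close>,
  apart from isolated vertices of the whole graph, which carry no points.\<close>

definition F :: "'e set \<Rightarrow> nat" where
  "F S = num_classes X (rel S)"

lemma sym_rel: "sym (rel S)"
  unfolding rel_def by (intro sym_Un sym_links r mk_inv)

text \<open>Lets infinite sets such as \<open>UNIV\<close> and complements stand for sets of
  edges.\<close>

lemma F_cong: "S \<inter> ed ` X = S' \<inter> ed ` X \<Longrightarrow> F S = F S'"
proof -
  assume h: "S \<inter> ed ` X = S' \<inter> ed ` X"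
  have "mk S p = mk S' p" if "p \<in> X" for p
  proof -
    have "ed p \<in> S \<longleftrightarrow> ed p \<in> S'" using h that by blast
    then show ?thesis by (simp add: mk_def)
  qed
  then have "links X (mk S) = links X (mk S')" by (auto simp: links_def)
  then show ?thesis by (simp add: F_def rel_def)
qed

text \<open>Results proved for the empty edge set transfer in this way to an arbitrary
  \<open>T\<close>; by \<open>mk_mk\<close>, dualising at \<open>T\<close> and then at
  \<open>S\<close> amounts to dualising at their symmetric difference.\<close>

lemma point_map_mk: "point_map X (mk T) (mk (- T)) r ed"
proof
  show "finite X" "fpf_involution_on X r" by (rule fin r)+
  show "fpf_involution_on X (mk T)" "fpf_involution_on X (mk (- T))" by (rule mk_inv)+
  fix p assume p: "p \<in> X"
  show "ed (mk T p) = ed p" "ed (mk (- T) p) = ed p" using p ed_m ed_u by (auto simp: mk_def)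
  show "mk T (mk (- T) p) = mk (- T) (mk T p)" using p ed_m ed_u mu by (auto simp: mk_def)
  show "mk T (mk (- T) p) \<noteq> p" using p ed_m ed_u mu mu_ne by (auto simp: mk_def)
  fix q assume q: "q \<in> X" "ed q = ed p"
  show "q \<in> {p, mk T p, mk (- T) p, mk T (mk (- T) p)}"
    using p ed_eq[OF p q] ed_m ed_u mu by (auto simp: mk_def)
qed

lemma mk_mk: "point_map.mk (mk T) (mk (- T)) ed S = mk (sym_diff T S)"
  by (rule ext) (auto simp: point_map.mk_def[OF point_map_mk] mk_def)

lemma F_mk: "point_map.F X (mk T) (mk (- T)) r ed S = F (sym_diff T S)"
  by (simp add: point_map.F_def[OF point_map_mk] point_map.rel_def[OF point_map_mk] F_def rel_def mk_mk)

subsection \<open>Removing one edge\<close>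

text \<open>The vertex boundaries with both segments of \<open>x\<close> opened. If \<open>x\<close>
  occurs, the classes are the circles missing \<open>x\<close> and two paths whose ends are the four
  points of \<open>x\<close>.\<close>

definition off :: "'e \<Rightarrow> ('p \<times> 'p) set" where
  "off x = links X r \<union> links {p \<in> X. ed p \<noteq> x} m"

lemma off_alt: "off x = links X r \<union> links (X - {p \<in> X. ed p = x}) m"
  unfolding off_def by (rule arg_cong[where f = "\<lambda>Z. links X r \<union> links Z m"]) auto

lemma m_off: "fpf_involution_on (X - {p \<in> X. ed p = x}) m"
  using m ed_m by (auto simp: fpf_involution_on_def)

lemma sym_off: "sym (off x)"
  unfolding off_alt by (intro sym_Un sym_links r m_off)

lemma off_subset: "off x \<subseteq> X \<times> X"
  using rD mD by (auto simp: off_def links_iff)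

lemma off_subset_rel: "off x \<subseteq> rel {}"
  by (auto simp: off_def rel_def links_iff mk_empty)

lemma off_r: "p \<in> X \<Longrightarrow> (p, r p) \<in> off x"
  and off_m: "p \<in> X \<Longrightarrow> ed p \<noteq> x \<Longrightarrow> (p, m p) \<in> off x"
  by (auto simp: off_def links_iff)

lemma off_class_subset: "p \<in> X \<Longrightarrow> (off x)\<^sup>* `` {p} \<subseteq> X"
  using off_subset by (intro class_subset) auto

lemma off_ends:
  assumes "p \<in> X"
  shows "\<exists>q. q \<noteq> p \<and> (off (ed p))\<^sup>* `` {p} \<inter> {q \<in> X. ed q = ed p} = {p, q}"
  unfolding off_alt by (rule path_ends[OF fin r m_off]) (use assms in auto)

text \<open>Here and in \<open>rel_single_eq\<close> the circles arise from the same opened paths,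
  by joining the four ends along the segments or along the free sides.\<close>

lemma rel_empty_eq:
  assumes "p \<in> X"
  shows "rel {} = off (ed p) \<union> {(p, m p), (m p, p)} \<union> {(u p, m (u p)), (m (u p), u p)}"
proof -
  have "links X m = links {q \<in> X. ed q \<noteq> ed p} m \<union> {(p, m p), (m p, p), (u p, m (u p)), (m (u p), u p)}"
    (is "?l = ?r")
  proof (rule set_eqI; clarify)
    fix a b
    have 1: "a \<in> {p, m p, u p, m (u p)}" if "a \<in> X" "ed a = ed p"
      using ed_eq[OF assms that] .
    show "(a, b) \<in> ?l \<longleftrightarrow> (a, b) \<in> ?r"
      using 1 assms mD uD by (auto simp: links_iff)
  qed
  then show ?thesis unfolding rel_def off_def mk_empty by auto
qed

lemma rel_single_eq:
  assumes "p \<in> X"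
  shows "rel {ed p} = off (ed p) \<union> {(p, u p), (u p, p)} \<union> {(m p, m (u p)), (m (u p), m p)}"
proof -
  have "links X (mk {ed p}) = links {q \<in> X. ed q \<noteq> ed p} m \<union>
      {(p, u p), (u p, p), (m p, m (u p)), (m (u p), m p)}"
    (is "?l = ?r")
  proof (rule set_eqI; clarify)
    fix a b
    have 1: "a \<in> {p, m p, u p, m (u p)}" if "a \<in> X" "ed a = ed p"
      using ed_eq[OF assms that] .
    have e: "ed (m p) = ed p" "ed (u p) = ed p" "ed (m (u p)) = ed p"
      "m p \<in> X" "u p \<in> X" "m (u p) \<in> X" "m (u p) = u (m p)" "u (u (m p)) = m p"
      using assms ed_m ed_u mD uD mu by auto
    have v: "mk {ed p} p = u p" "mk {ed p} (u p) = p" "mk {ed p} (m p) = m (u p)"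
        "mk {ed p} (m (u p)) = m p"
      using e assms uD mD by (auto simp: mk_def)
    have w: "mk {ed p} a = m a" if "ed a \<noteq> ed p" using that by (simp add: mk_def)
    show "(a, b) \<in> ?l \<longleftrightarrow> (a, b) \<in> ?r"
    proof (cases "a \<in> X \<and> ed a = ed p")
      case True
      then show ?thesis using 1 v assms by (auto simp: links_iff)
    next
      case False
      then have "a \<notin> {p, m p, u p, m (u p)}" using e assms by auto
      then show ?thesis using w False by (auto simp: links_iff)
    qed
  qed
  then show ?thesis unfolding rel_def off_def by auto
qed

lemma F_single_le: "F {x} \<le> F {} + 1"
proof (cases "x \<in> ed ` X")
  case True
  then obtain p where p: "p \<in> X" "x = ed p" by auto
  show ?thesis unfolding F_def p(2) rel_single_eq[OF p(1)] rel_empty_eq[OF p(1)]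
    by (rule num_classes_switch_le) (use p fin sym_off mD uD in auto)
next
  case False
  then have "F {x} = F {}" by (intro F_cong) auto
  then show ?thesis by simp
qed

text \<open>The edge joins two different vertices. Each path of \<open>off (ed p)\<close> then runs
  between the two ends of one segment, as any other end would put \<open>p\<close> and
  \<open>u p\<close> on one circle; rejoining along the sides fuses the two circles.\<close>

lemma F_single_merge:
  assumes p: "p \<in> X" and "(p, u p) \<notin> (rel {})\<^sup>*"
  shows "F {ed p} + 1 = F {}"
proof -
  let ?O = "off (ed p)"
  have sub: "?O\<^sup>* \<subseteq> (rel {})\<^sup>*" by (rule rtrancl_mono[OF off_subset_rel])
  have mrel: "(q, m q) \<in> rel {}" if "q \<in> X" for q using that by (simp add: rel_def links_iff mk_empty)
  have symr: "(a, b) \<in> (rel {})\<^sup>* \<Longrightarrow> (b, a) \<in> (rel {})\<^sup>*" for a b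
    using sym_rel by (meson sym_rtrancl symE)
  have key: "(q, m q) \<in> ?O\<^sup>*" if q: "q \<in> X" "ed q = ed p" "(q, u q) \<notin> (rel {})\<^sup>*" for q
  proof -
    obtain q' where q': "q' \<noteq> q" "?O\<^sup>* `` {q} \<inter> {z \<in> X. ed z = ed p} = {q, q'}"
      using off_ends[OF q(1)] q(2) by auto
    then have 1: "q' \<in> X" "ed q' = ed q" "(q, q') \<in> ?O\<^sup>*" using q(2) by auto
    then have "q' \<in> {m q, u q, m (u q)}" using ed_eq[OF q(1)] q' by auto
    moreover have "q' \<noteq> u q" using 1 q sub by auto
    moreover have "q' \<noteq> m (u q)"
    proof
      assume "q' = m (u q)"
      then have "(q, m (u q)) \<in> (rel {})\<^sup>*" using 1 sub by auto
      moreover have "(m (u q), u q) \<in> rel {}" using mrel[of "m (u q)"] q mD uD by simp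
      ultimately show False using q by (meson rtrancl_into_rtrancl)
    qed
    ultimately show ?thesis using 1 by auto
  qed
  have 1: "(p, m p) \<in> ?O\<^sup>*" by (rule key) (use assms in auto)
  have 2: "(u p, m (u p)) \<in> ?O\<^sup>*"
    by (rule key) (use assms uD ed_u symr in auto)
  have 3: "(p, u p) \<notin> ?O\<^sup>*" using assms sub by auto
  show ?thesis unfolding F_def rel_single_eq[OF p] rel_empty_eq[OF p]
    by (rule num_classes_switch_eq) (use 1 2 3 p fin sym_off mD uD in auto)
qed

section \<open>Bouquets as partial duals and the rank function\<close>

lemma F_pos: "X \<noteq> {} \<Longrightarrow> F S \<ge> 1"
  unfolding F_def using fin by (rule num_classes_pos)

lemma F_insert_le: "F (insert x S) \<le> F S + 1"
proof (cases "x \<in> S")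
  case False
  then have "sym_diff S {x} = insert x S" by auto
  then show ?thesis using point_map.F_single_le[OF point_map_mk, of S x] by (simp add: F_mk)
qed (simp add: insert_absorb)

lemma rel_mk: "point_map.rel X (mk T) (mk (- T)) r ed S = rel (sym_diff T S)"
  by (simp add: point_map.rel_def[OF point_map_mk] rel_def mk_mk)

text \<open>A \<open>T\<close> minimising \<open>F\<close> works: by \<open>F_single_merge\<close>,
  toggling an edge between two circles would lose a circle. So all three involutions preserve the
  circles, and connectedness leaves only one.\<close>

lemma exists_bouquet:
  assumes "X \<noteq> {}" and conn: "\<And>p q. p \<in> X \<Longrightarrow> q \<in> X \<Longrightarrow> (p, q) \<in> (links X r \<union> links X m \<union> links X u)\<^sup>*"
  shows "\<exists>T. F T = 1"
proof -
  obtain T where T: "\<And>S. F T \<le> F S" using ex_has_least_nat[of "\<lambda>_. True" undefined F] by auto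
  have 1: "(p, mk (- T) p) \<in> (rel T)\<^sup>*" if "p \<in> X" for p
  proof (rule ccontr)
    assume "(p, mk (- T) p) \<notin> (rel T)\<^sup>*"
    then have "F (sym_diff T {ed p}) + 1 = F T"
      using point_map.F_single_merge[OF point_map_mk that, of T] by (simp add: F_mk rel_mk)
    then show False using T[of "sym_diff T {ed p}"] by simp
  qed
  have 2: "(p, mk T p) \<in> (rel T)\<^sup>*" "(p, r p) \<in> (rel T)\<^sup>*" if "p \<in> X" for p
    using that by (auto simp: rel_def links_iff)
  have "(p, m p) \<in> (rel T)\<^sup>*" "(p, u p) \<in> (rel T)\<^sup>*" if "p \<in> X" for p
    using 1[OF that] 2(1)[OF that] by (auto simp: mk_def split: if_splits)
  then have "links X r \<union> links X m \<union> links X u \<subseteq> (rel T)\<^sup>*"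
    using 2 by (auto simp: links_iff)
  then have "(links X r \<union> links X m \<union> links X u)\<^sup>* \<subseteq> (rel T)\<^sup>*"
    by (metis rtrancl_idemp rtrancl_mono)
  then have "F T = 1" unfolding F_def num_classes_eq_1_iff[OF sym_rel] using assms by blast
  then show ?thesis ..
qed

text \<open>Each added edge raises the cardinality by one and \<open>F\<close> by at most one. In a
  bouquet this is the monotonicity of the rank.\<close>

lemma F_card_mono:
  assumes "finite S'" "S \<subseteq> S'"
  shows "int (card S) - int (F S) \<le> int (card S') - int (F S')"
proof -
  have "finite D \<Longrightarrow> D \<inter> S = {} \<Longrightarrow> int (card S) - int (F S) \<le> int (card (S \<union> D)) - int (F (S \<union> D))" for D
  proof (induction D rule: finite_induct)
    case (insert x D)
    have "card (S \<union> insert x D) = card (S \<union> D) + 1"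
      using insert assms finite_subset[OF assms(2)] by auto
    then show ?case using insert F_insert_le[of x "S \<union> D"] by simp
  qed simp
  moreover have "finite (S' - S)" "(S' - S) \<inter> S = {}" "S \<union> (S' - S) = S'" using assms by auto
  ultimately show ?thesis by metis
qed

section \<open>Loops of a bouquet and their interlacement\<close>

context
  assumes one: "F {} = 1"
begin

lemma rel_connected: "p \<in> X \<Longrightarrow> q \<in> X \<Longrightarrow> (p, q) \<in> (rel {})\<^sup>*"
  using one unfolding F_def num_classes_eq_1_iff[OF sym_rel] by blast

lemma rel_closed:
  assumes "C \<subseteq> X" "C \<noteq> {}" "\<And>z. z \<in> C \<Longrightarrow> r z \<in> C" "\<And>z. z \<in> C \<Longrightarrow> m z \<in> C"
  shows "C = X"
proof -
  obtain c where c: "c \<in> C" using assms by auto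
  have "(rel {})\<^sup>* `` {c} \<subseteq> C"
  proof (rule class_subset[OF c], rule subsetI)
    fix y assume "y \<in> rel {} `` C"
    then obtain z where "z \<in> C" "y = r z \<or> y = m z" by (auto simp: rel_def links_iff mk_empty)
    then show "y \<in> C" using assms(3,4) by blast
  qed
  then show ?thesis using assms(1) c rel_connected by blast
qed

lemma off_closed:
  assumes "z \<in> (off x)\<^sup>* `` {p}" "p \<in> X"
  shows "r z \<in> (off x)\<^sup>* `` {p}" "ed z \<noteq> x \<Longrightarrow> m z \<in> (off x)\<^sup>* `` {p}"
proof -
  have "z \<in> X" using assms off_class_subset by blast
  then show "r z \<in> (off x)\<^sup>* `` {p}" "ed z \<noteq> x \<Longrightarrow> m z \<in> (off x)\<^sup>* `` {p}"
    using assms(1) off_r off_m by (auto intro: rtrancl_into_rtrancl)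
qed

text \<open>If the path from \<open>p\<close> ended at \<open>m p\<close>, the segment would close
  it to the whole circle, but the path misses \<open>u p\<close>.\<close>

lemma off_ends_cases:
  assumes p: "p \<in> X"
  obtains q where "q = u p \<or> q = m (u p)"
    "(off (ed p))\<^sup>* `` {p} \<inter> {z \<in> X. ed z = ed p} = {p, q}"
proof -
  let ?D = "(off (ed p))\<^sup>* `` {p}"
  obtain q where q: "q \<noteq> p" "?D \<inter> {z \<in> X. ed z = ed p} = {p, q}" using off_ends[OF p] by auto
  then have "q \<in> X" "ed q = ed p" by auto
  then have "q \<in> {m p, u p, m (u p)}" using ed_eq[OF p] q by auto
  moreover have "q \<noteq> m p"
  proof
    assume "q = m p"
    then have "?D = X"
    proof (intro rel_closed off_class_subset p)
      fix z assume z: "z \<in> ?D"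
      show "r z \<in> ?D" using off_closed z p by blast
      show "m z \<in> ?D"
      proof (cases "ed z = ed p")
        case True
        then have "z \<in> {p, m p}" using z q off_class_subset[OF p] \<open>q = m p\<close> by blast
        moreover have "p \<in> ?D" "m p \<in> ?D" using q \<open>q = m p\<close> by auto
        ultimately show ?thesis using mD p by auto
      qed (use off_closed z p in blast)
    qed auto
    then have "u p \<in> {p, q}" using uD[OF p] ed_u[OF p] q by blast
    then show False using uD[OF p] mu_ne'[OF p] \<open>q = m p\<close> by auto
  qed
  ultimately show thesis using that[of q] q by blast
qed

lemma off_m_not: "p \<in> X \<Longrightarrow> (p, m p) \<notin> (off (ed p))\<^sup>*"
proof
  assume p: "p \<in> X" and "(p, m p) \<in> (off (ed p))\<^sup>*"
  then have 1: "m p \<in> (off (ed p))\<^sup>* `` {p} \<inter> {z \<in> X. ed z = ed p}" using mD ed_m by auto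
  obtain q where "q = u p \<or> q = m (u p)"
    "(off (ed p))\<^sup>* `` {p} \<inter> {z \<in> X. ed z = ed p} = {p, q}" using off_ends_cases[OF p] by metis
  then show False using 1 mu_ne' mD uD p by (metis insertE singletonD)
qed

text \<open>The segments of a loop cut the circle into two paths. They start at \<open>p\<close> and
  \<open>m p\<close>, and their other ends are the remaining two points of the edge, so their union
  is closed under \<open>r\<close> and \<open>m\<close>.\<close>

lemma off_cover:
  assumes p: "p \<in> X"
  shows "X = (off (ed p))\<^sup>* `` {p} \<union> (off (ed p))\<^sup>* `` {m p}" (is "X = ?D \<union> ?E")
proof -
  have mp: "m p \<in> X" "ed (m p) = ed p" using p mD ed_m by auto
  obtain q where q: "q = u p \<or> q = m (u p)" "?D \<inter> {z \<in> X. ed z = ed p} = {p, q}"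
    using off_ends_cases[OF p] by metis
  obtain q' where q': "q' = u (m p) \<or> q' = m (u (m p))" "?E \<inter> {z \<in> X. ed z = ed p} = {m p, q'}"
    using off_ends_cases[OF mp(1)] mp(2) by metis
  have "(p, m p) \<notin> (off (ed p))\<^sup>*" using off_m_not p by blast
  then have disj: "?D \<inter> ?E = {}"
    using class_eq[OF sym_off[of "ed p"], of p] class_eq[OF sym_off[of "ed p"], of "m p"] by blast
  have "q' \<noteq> q" using q q' disj by blast
  moreover have e: "u (m p) = m (u p)" "m (u (m p)) = u p" using mu[OF p] mD[of "u p"] uD[of p] p by simp_all
  ultimately have qq: "{q, q'} = {u p, m (u p)}" using q(1) q'(1) by auto
  have pts: "z \<in> ?D \<union> ?E" if "z \<in> X" "ed z = ed p" for z
    using ed_eq[OF p that] q(2) q'(2) qq by blast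
  have "?D \<union> ?E = X"
  proof (rule rel_closed)
    show "?D \<union> ?E \<subseteq> X" using off_class_subset p mp by blast
    fix z assume z: "z \<in> ?D \<union> ?E"
    then have "z \<in> X" using off_class_subset p mp by blast
    show "r z \<in> ?D \<union> ?E" using z off_closed p mp by blast
    show "m z \<in> ?D \<union> ?E"
    proof (cases "ed z = ed p")
      case True then show ?thesis using pts mD ed_m \<open>z \<in> X\<close> by simp
    qed (use z off_closed p mp in blast)
  qed auto
  then show ?thesis ..
qed

text \<open>If instead the path from \<open>p\<close> ends at \<open>m (u p)\<close>, i.e. the loop
  is twisted, rejoining along the sides gives a single circle again.\<close>

lemma off_untwisted:
  assumes p: "p \<in> X" and two: "F {ed p} \<noteq> 1"
  shows "(p, u p) \<in> (off (ed p))\<^sup>*"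
proof (rule ccontr)
  assume no: "\<not> ?thesis"
  let ?O = "off (ed p)" and ?R = "rel {ed p}"
  obtain q where q: "q = u p \<or> q = m (u p)" "?O\<^sup>* `` {p} \<inter> {z \<in> X. ed z = ed p} = {p, q}"
    using off_ends_cases[OF p] by metis
  then have 1: "(p, m (u p)) \<in> ?O\<^sup>*" using no by auto
  have OR: "?O\<^sup>* \<subseteq> ?R\<^sup>*" unfolding rel_single_eq[OF p] by (rule rtrancl_mono) auto
  have "(m (u p), m p) \<in> ?R" using rel_single_eq[OF p] by auto
  then have pm: "(p, m p) \<in> ?R\<^sup>*" using 1 OR by (meson rtrancl_into_rtrancl subsetD)
  have "(p, z) \<in> ?R\<^sup>*" if "z \<in> X" for z
    using off_cover[OF p] that OR pm by (auto intro: rtrancl_trans)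
  then have "(z, z') \<in> ?R\<^sup>*" if "z \<in> X" "z' \<in> X" for z z'
    using that sym_rel by (meson rtrancl_trans sym_rtrancl symE)
  then have "F {ed p} = 1" unfolding F_def num_classes_eq_1_iff[OF sym_rel] using p by auto
  then show False using two by simp
qed

text \<open>The conclusion says that the two segments of the edge of \<open>q\<close> are not separated by those of \<open>x\<close>.\<close>

lemma not_interlaced_untwisted:
  assumes q: "q \<in> X" "ed q \<noteq> x" and x: "x \<in> ed ` X" and Fx: "F {x} \<noteq> 1" and Fxy: "F {x, ed q} \<noteq> 1"
  shows "(q, u q) \<in> (off x)\<^sup>*"
proof (rule ccontr)
  assume no: "\<not> ?thesis"
  obtain p where p: "p \<in> X" "ed p = x" using x by auto
  have "F {x} \<ge> 1" using p F_pos by auto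
  then have two: "F {x} = 2" using F_single_le[of x] one Fx by simp
  have "(p, u p) \<in> (off x)\<^sup>*" "(m p, m (u p)) \<in> (off x)\<^sup>*"
    using off_untwisted[of p] off_untwisted[of "m p"] p Fx mD ed_m mu by auto
  \<comment> \<open>As \<open>x\<close> is untwisted, its sides merely close up the two paths, so
    circles for \<open>{x}\<close> correspond to classes of \<open>off x\<close>. If the edge of
    \<open>q\<close> joined two of them, toggling it as well would leave only one.\<close>
  then have "rel {x} \<subseteq> (off x)\<^sup>*"
    using rel_single_eq[OF p(1)] p(2) sym_off[of x] by (auto dest: symD[OF sym_rtrancl])
  then have "(rel {x})\<^sup>* \<subseteq> (off x)\<^sup>*" by (metis rtrancl_idemp rtrancl_mono)
  then have "(q, mk (- {x}) q) \<notin> (rel {x})\<^sup>*" using no q by (auto simp: mk_def)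
  then have "F (sym_diff {x} {ed q}) + 1 = F {x}"
    using point_map.F_single_merge[OF point_map_mk q(1), of "{x}"] by (simp add: F_mk rel_mk)
  moreover have "sym_diff {x} {ed q} = {x, ed q}" using q by auto
  ultimately show False using two Fxy by simp
qed

lemma off_off_same_class:
  assumes p: "p \<in> X" and q: "q \<in> X" and ne: "ed p \<noteq> ed q"
    and pp: "(p, u p) \<in> (off (ed q))\<^sup>*"
    and z: "z \<in> X" "ed z = ed p"
  shows "(p, z) \<in> (off (ed q))\<^sup>*"
proof -
  let ?O = "off (ed q)"
  have "(p, m p) \<in> ?O" "(u p, m (u p)) \<in> ?O" using off_m p ne uD ed_u by simp_all
  then show ?thesis using ed_eq[OF p z] pp by (auto intro: rtrancl_into_rtrancl)
qed

text \<open>A link of \<open>off y\<close> that starts outside the edge \<open>x\<close> is a link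
  of \<open>off x\<close> too.\<close>

lemma off_class_avoiding:
  assumes "b \<in> X" and av: "\<And>z. z \<in> (off y)\<^sup>* `` {b} \<Longrightarrow> ed z \<noteq> x"
  shows "(off y)\<^sup>* `` {b} \<subseteq> (off x)\<^sup>* `` {b}"
proof
  fix z assume "z \<in> (off y)\<^sup>* `` {b}"
  then have "(b, z) \<in> (off y)\<^sup>*" by auto
  then have "(b, z) \<in> (off x)\<^sup>*"
  proof (induction rule: rtrancl_induct)
    case (step z z')
    then have "z \<in> X" "ed z \<noteq> x" using off_subset av by auto
    moreover have "z' = r z \<or> z' = m z" using step by (auto simp: off_def links_iff)
    ultimately have "(z, z') \<in> off x" using off_r off_m by auto
    then show ?case using step by auto
  qed auto
  then show "z \<in> (off x)\<^sup>* `` {b}" by auto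
qed

text \<open>All points of the edge of \<open>p\<close> lie in one class, which cannot contain both
  \<open>q\<close> and \<open>m q\<close>.\<close>

lemma off_avoiding_end:
  assumes p: "p \<in> X" and q: "q \<in> X" and ne: "ed p \<noteq> ed q"
    and pp: "(p, u p) \<in> (off (ed q))\<^sup>*"
  obtains b where "b = q \<or> b = m q" "\<And>z. z \<in> (off (ed q))\<^sup>* `` {b} \<Longrightarrow> ed z \<noteq> ed p"
proof -
  let ?O = "off (ed q)"
  have "p \<notin> ?O\<^sup>* `` {q} \<or> p \<notin> ?O\<^sup>* `` {m q}"
    using off_m_not[OF q] class_eq[OF sym_off[of "ed q"], of q p]
      class_eq[OF sym_off[of "ed q"], of "m q" p] by blast
  then obtain b where b: "b = q \<or> b = m q" "p \<notin> ?O\<^sup>* `` {b}" by blast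
  then have bX: "b \<in> X" using q mD by auto
  have "ed z \<noteq> ed p" if z: "z \<in> ?O\<^sup>* `` {b}" for z
  proof
    assume e: "ed z = ed p"
    have zX: "z \<in> X" using z off_class_subset bX by blast
    have "(p, z) \<in> ?O\<^sup>*" by (rule off_off_same_class[OF p q ne pp zX e])
    then have "(z, p) \<in> ?O\<^sup>*" by (meson sym_off sym_rtrancl symE)
    then show False using z b by (auto intro: rtrancl_trans)
  qed
  then show thesis using b that by blast
qed

text \<open>The bound on the sum makes one of the two loops untwisted. If it is \<open>x\<close>,
  the previous argument applies directly; otherwise the loops are exchanged and the conclusion is
  turned around, interlacement being symmetric.\<close>

lemma not_interlaced:
  assumes q: "q \<in> X" "ed q \<noteq> x" and x: "x \<in> ed ` X"
    and Fx: "F {x} + F {ed q} \<ge> 3" and Fxy: "F {x, ed q} \<noteq> 1"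
  shows "(q, u q) \<in> (off x)\<^sup>*"
proof (cases "F {x} = 1")
  case False
  then show ?thesis using not_interlaced_untwisted assms by auto
next
  case True
  then have Fy: "F {ed q} \<noteq> 1" using Fx by simp
  obtain p where p: "p \<in> X" "ed p = x" using x by auto
  have pp: "(p, u p) \<in> (off (ed q))\<^sup>*"
    using not_interlaced_untwisted[of p "ed q"] p q Fy Fxy by (simp add: insert_commute)
  obtain b where b: "b = q \<or> b = m q" "\<And>z. z \<in> (off (ed q))\<^sup>* `` {b} \<Longrightarrow> ed z \<noteq> ed p"
    using off_avoiding_end[OF p(1) q(1) _ pp] p q by metis
  have bX: "b \<in> X" "ed b = ed q" using b q mD ed_m by auto
  \<comment> \<open>The path from \<open>b\<close> to \<open>u b\<close> avoids the edge
    \<open>x\<close>, hence it survives in \<open>off x\<close>.\<close>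
  have "u b \<in> (off (ed q))\<^sup>* `` {b}" using off_untwisted[OF bX(1)] bX Fy by simp
  then have ub: "(b, u b) \<in> (off x)\<^sup>*"
    using off_class_avoiding[OF bX(1)] b(2) p by blast
  show ?thesis
  proof (cases "b = q")
    case False
    then have bq: "b = m q" using b by auto
    have 1: "(q, b) \<in> off x" using off_m q bq by auto
    have "(u b, m (u b)) \<in> off x" using off_m[of "u b"] bX uD ed_u q by simp
    moreover have "m (u b) = u q" using mu bX mD uD bq q by metis
    ultimately show ?thesis using 1 ub
      by (metis converse_rtrancl_into_rtrancl rtrancl_into_rtrancl)
  qed (use ub in simp)
qed

text \<open>The minimal part cut off by an edge of the other colour consists of monochromatic
  edges only, and a run of them is not left by any edge.\<close>

lemma exists_run:
  assumes non: "\<And>p q. p \<in> X \<Longrightarrow> q \<in> X \<Longrightarrow> (ed p \<in> A) \<noteq> (ed q \<in> A) \<Longrightarrow> (q, u q) \<in> (off (ed p))\<^sup>*"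
    and ex: "p0 \<in> X" "q0 \<in> X" "(ed p0 \<in> A) \<noteq> (ed q0 \<in> A)"
  shows "\<exists>W\<subseteq>X. W \<noteq> {} \<and> (\<forall>w\<in>W. m w \<in> W \<and> u w \<in> W) \<and>
    ((\<forall>w\<in>W. ed w \<in> A) \<or> (\<forall>w\<in>W. ed w \<notin> A)) \<and> card {w \<in> W. r w \<notin> W} = 2"
proof -
  define col where "col z \<longleftrightarrow> ed z \<in> A" for z
  let ?P = "\<lambda>(p, q). p \<in> X \<and> q \<in> X \<and> col p \<noteq> col q"
  let ?J = "\<lambda>(p, q). (off (ed p))\<^sup>* `` {q}"
  have "?P (p0, q0)" using ex by (simp add: col_def)
  \<comment> \<open>Among all pairs of different colours, whichever of the two has which, the path
    cut off by the edge of \<open>p\<close> and containing \<open>q\<close> is chosen as short as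
    possible.\<close>
  then have "\<exists>pq. ?P pq \<and> (\<forall>pq'. ?P pq' \<longrightarrow> card (?J pq) \<le> card (?J pq'))"
    by (rule ex_has_least_nat)
  then obtain p q where pq: "p \<in> X" "q \<in> X" "col p \<noteq> col q"
    and min: "\<And>p' q'. p' \<in> X \<Longrightarrow> q' \<in> X \<Longrightarrow> col p' \<noteq> col q' \<Longrightarrow> card (?J (p, q)) \<le> card (?J (p', q'))"
    by fastforce
  let ?J = "(off (ed p))\<^sup>* `` {q}"
  \<comment> \<open>\<open>Z\<close> marks the arcs at which the colour changes. The classes of
    \<open>L\<close> are the maximal runs of one colour, and \<open>?W\<close> is the run of
    \<open>q\<close>.\<close>
  define Z where "Z = {z \<in> X. col z \<noteq> col (r z)}"
  define L where "L = links X m \<union> links (X - Z) r"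
  let ?W = "L\<^sup>* `` {q}"
  have JX: "?J \<subseteq> X" by (rule off_class_subset[OF pq(2)])
  have rinv: "fpf_involution_on (X - Z) r"
    using rD by (auto simp: Z_def fpf_involution_on_def)
  have symL: "sym L" unfolding L_def by (intro sym_Un sym_links m rinv)
  have colm: "col (m z) = col z" and colu: "col (u z) = col z" if "z \<in> X" for z
    using that ed_m ed_u by (auto simp: col_def)
  have Lm: "(z, m z) \<in> L" if "z \<in> X" for z using that by (auto simp: L_def links_iff)
  have Lr: "(z, r z) \<in> L" if "z \<in> X" "col (r z) = col z" for z using that by (auto simp: L_def Z_def links_iff)
  \<comment> \<open>Minimality enters here. One of the two paths between the segments of the loop at
    \<open>b\<close> avoids the edge of \<open>p\<close> and lies strictly inside \<open>?J\<close>,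
    so it is monochromatic and belongs to a single run.\<close>
  have loop: "(b, u b) \<in> L\<^sup>*" if b: "b \<in> ?J" "col b = col q" for b
  proof -
    have bX: "b \<in> X" using b JX by blast
    have ne: "ed p \<noteq> ed b" using b pq by (auto simp: col_def)
    have pp: "(p, u p) \<in> (off (ed b))\<^sup>*" by (rule non) (use bX pq b in \<open>auto simp: col_def\<close>)
    have bb: "(b, u b) \<in> (off (ed p))\<^sup>*" by (rule non) (use bX pq b in \<open>auto simp: col_def\<close>)
    obtain b' where b': "b' = b \<or> b' = m b" "\<And>z. z \<in> (off (ed b))\<^sup>* `` {b'} \<Longrightarrow> ed z \<noteq> ed p"
      using off_avoiding_end[OF pq(1) bX ne pp] by blast
    let ?D = "(off (ed b))\<^sup>* `` {b'}"
    have b'X: "b' \<in> X" "ed b' = ed b" using b' bX mD ed_m by auto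
    have b'J: "b' \<in> ?J" using b' b(1) off_closed(2)[OF b(1) pq(2)] ne by auto
    have DJ: "?D \<subseteq> ?J"
      using off_class_avoiding[OF b'X(1) b'(2)] b'J class_eq[OF sym_off[of "ed p"], of q b'] by auto
    obtain e where e: "e = u b' \<or> e = m (u b')" "?D \<inter> {z \<in> X. ed z = ed b'} = {b', e}"
      using off_ends_cases[OF b'X(1)] b'X(2) by metis
    have four: "z \<in> ?J" if "z \<in> X" "ed z = ed b" for z
    proof -
      have "(b, z) \<in> (off (ed p))\<^sup>*"
        by (rule off_off_same_class[OF bX pq(1) ne[symmetric] bb that])
      then show ?thesis using b(1) by (auto intro: rtrancl_trans)
    qed
    have mb': "m b' \<in> ?J" using four b'X mD ed_m by auto
    have "m b' \<notin> ?D"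
      using off_m_not[OF b'X(1)] b'X(2) by auto
    then have "?D \<subset> ?J" using DJ mb' by blast
    then have lt: "card ?D < card ?J" using JX fin by (meson finite_subset psubset_card_mono)
    have mono: "col z = col b" if z: "z \<in> ?D" for z
    proof (rule ccontr)
      assume c: "col z \<noteq> col b"
      have "z \<in> X" using z DJ JX by blast
      then have "card ?J \<le> card ((off (ed b))\<^sup>* `` {z})" using min[OF bX, of z] c by auto
      moreover have "(off (ed b))\<^sup>* `` {z} = ?D" using class_eq[OF sym_off[of "ed b"], of b' z] z by auto
      ultimately show False using lt by simp
    qed
    have "(b', z) \<in> L\<^sup>*" if "(b', z) \<in> (off (ed b))\<^sup>*" for z
      using that
    proof (induction rule: rtrancl_induct)
      case (step z z')
      then have "z \<in> ?D" "z' \<in> ?D" by (auto intro: rtrancl_into_rtrancl)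
      then have zz: "z \<in> X" "col z' = col z" using mono DJ JX by auto
      have "z' = r z \<or> z' = m z" using step by (auto simp: off_def links_iff)
      then have "(z, z') \<in> L" using Lm[OF zz(1)] Lr[OF zz(1)] zz(2) by (elim disjE) simp_all
      then show ?case using step by auto
    qed auto
    then have be: "(b', e) \<in> L\<^sup>*" using e by auto
    have ub'X: "u b' \<in> X" "m (u b') \<in> X" using b'X uD mD by auto
    have bu: "(b', u b') \<in> L\<^sup>*"
    proof (cases "e = u b'")
      case False
      then have "(e, u b') \<in> L" using e(1) Lm[of "m (u b')"] mD ub'X by auto
      then show ?thesis using be by (rule rtrancl_into_rtrancl[rotated])
    qed (use be in simp)
    show ?thesis
    proof (cases "b' = b")
      case False
      then have "b' = m b" using b' by auto
      then have "(b, b') \<in> L" "(u b', u b) \<in> L"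
        using Lm[OF bX] Lm[OF ub'X(1)] mu bX mD uD by metis+
      then show ?thesis using bu by (meson converse_rtrancl_into_rtrancl rtrancl_into_rtrancl)
    qed (use bu in simp)
  qed
  \<comment> \<open>The run cannot cross a segment of the edge of \<open>p\<close>, which has the
    other colour.\<close>
  have WJ: "?W \<subseteq> {z \<in> ?J. col z = col q}"
  proof (rule class_subset)
    show "L `` {z \<in> ?J. col z = col q} \<subseteq> {z \<in> ?J. col z = col q}"
    proof
      fix z' assume "z' \<in> L `` {z \<in> ?J. col z = col q}"
      then obtain z where z: "z \<in> ?J" "col z = col q" "(z, z') \<in> L" by blast
      then have zX: "z \<in> X" and ne: "ed z \<noteq> ed p" using JX pq by (auto simp: col_def)
      consider "z' = m z" | "z' = r z" "col z' = col z" using z by (auto simp: L_def Z_def links_iff)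
      then show "z' \<in> {z \<in> ?J. col z = col q}"
      proof cases
        case 1 then show ?thesis using off_closed(2)[OF z(1) pq(2) ne] colm zX z by simp
      next
        case 2 then show ?thesis using off_closed(1)[OF z(1) pq(2)] z by simp
      qed
    qed
  qed auto
  have WX: "?W \<subseteq> X" using WJ JX by blast
  have Wstep: "z' \<in> ?W" if "z \<in> ?W" "(z, z') \<in> L\<^sup>*" for z z'
    using that by (auto intro: rtrancl_trans)
  have Wm: "m w \<in> ?W" if "w \<in> ?W" for w
    using Wstep[OF that] Lm WX that by blast
  have Wu: "u w \<in> ?W" if "w \<in> ?W" for w
    using Wstep[OF that] loop WJ that by blast
  have Wr: "r w \<in> ?W" if "w \<in> ?W" "w \<notin> Z" for w
  proof -
    have "w \<in> X" using that WX by blast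
    then show ?thesis using Wstep[OF that(1)] Lr[of w] that unfolding Z_def by blast
  qed
  have Wcol: "col w = col q" if "w \<in> ?W" for w using that WJ by blast
  have qW: "q \<in> ?W" by auto
  \<comment> \<open>Without a change of colour the run would be the whole circle and contain
    \<open>p\<close>. So it is a path, and \<open>path_ends\<close> gives it exactly two
    ends.\<close>
  have "\<exists>z. z \<in> ?W \<inter> Z"
  proof (rule ccontr)
    assume "\<not> ?thesis"
    then have "?W = X" using WX qW Wm Wr by (intro rel_closed) auto
    then show False using Wcol pq by blast
  qed
  then obtain z where z: "z \<in> ?W" "z \<in> Z" by blast
  have "L\<^sup>* `` {z} = ?W" using class_eq[OF symL, of q z] z by auto
  then obtain z' where z': "z' \<noteq> z" "?W \<inter> Z = {z, z'}"
    using path_ends[OF fin m rinv _ z(2)] unfolding L_def[symmetric] by (auto simp: Z_def)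
  have "{w \<in> ?W. r w \<notin> ?W} = ?W \<inter> Z"
  proof -
    have "r w \<notin> ?W" if "w \<in> ?W" "w \<in> Z" for w using Wcol[of w] Wcol[of "r w"] that by (auto simp: Z_def)
    then show ?thesis using Wr by blast
  qed
  then have "card {w \<in> ?W. r w \<notin> ?W} = 2" using z' by simp
  moreover have "(\<forall>w\<in>?W. ed w \<in> A) \<or> (\<forall>w\<in>?W. ed w \<notin> A)"
    using Wcol unfolding col_def by blast
  ultimately show ?thesis using WX Wm Wu qW by blast
qed

end

section \<open>From low genus to a monochromatic run\<close>

lemma rank_bound:
  assumes one: "F {} = 1"
    and le: "int (card (ed ` X)) + 2 - int (F (ed ` X \<inter> T)) - int (F (ed ` X - T)) \<le> 1"
    and xy: "x \<in> ed ` X" "y \<in> ed ` X" "x \<noteq> y"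
  shows "if x \<in> T \<longleftrightarrow> y \<in> T then F {x, y} \<noteq> 1 else F {x} + F {y} \<ge> 3"
proof -
  let ?S = "ed ` X \<inter> T" and ?S' = "ed ` X - T"
  have f: "finite ?S" "finite ?S'" using fin by auto
  have c: "card (ed ` X) = card ?S + card ?S'"
    using card_Int_Diff[of "ed ` X" T] fin by simp
  \<comment> \<open>These are the ranks \<rho> of the two sides of \<open>T\<close>, and
    \<open>le\<close> bounds their sum by 1. By monotonicity a pair on one side has rank at most 1,
    and two edges on different sides have ranks with sum at most 1.\<close>
  have 0: "int (card ?S) + 1 - int (F ?S) \<ge> 0" "int (card ?S') + 1 - int (F ?S') \<ge> 0"
    using F_card_mono[OF f(1), of "{}"] F_card_mono[OF f(2), of "{}"] one by simp_all
  have pair: "card {x, y} = 2" using xy by simp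
  consider "{x, y} \<subseteq> ?S" | "{x, y} \<subseteq> ?S'" | "{x} \<subseteq> ?S" "{y} \<subseteq> ?S'" | "{x} \<subseteq> ?S'" "{y} \<subseteq> ?S"
    using xy by blast
  then show ?thesis
  proof cases
    case 1
    then show ?thesis using F_card_mono[OF f(1) 1] pair c 0 le by auto
  next
    case 2
    then show ?thesis using F_card_mono[OF f(2) 2] pair c 0 le by auto
  next
    case 3
    then show ?thesis using F_card_mono[OF f(1) 3(1)] F_card_mono[OF f(2) 3(2)] c le by auto
  next
    case 4
    then show ?thesis using F_card_mono[OF f(2) 4(1)] F_card_mono[OF f(1) 4(2)] c le by auto
  qed
qed

text \<open>If exactly one of two edges lies in \<open>A\<close>, they are on the same side of one
  of \<open>T\<close>, \<open>T'\<close> and on different sides of the other, so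
  \<open>rank_bound\<close> supplies both conditions of \<open>not_interlaced\<close>.\<close>

lemma exists_run_bouquet:
  assumes one: "F {} = 1"
    and le: "int (card (ed ` X)) + 2 - int (F (ed ` X \<inter> T)) - int (F (ed ` X - T)) \<le> 1"
    and le': "int (card (ed ` X)) + 2 - int (F (ed ` X \<inter> T')) - int (F (ed ` X - T')) \<le> 1"
    and A: "A = sym_diff T T'"
    and ex: "p0 \<in> X" "q0 \<in> X" "ed p0 \<in> A" "ed q0 \<notin> A"
  shows "\<exists>W\<subseteq>X. W \<noteq> {} \<and> (\<forall>w\<in>W. m w \<in> W \<and> u w \<in> W) \<and>
    ((\<forall>w\<in>W. ed w \<in> A) \<or> (\<forall>w\<in>W. ed w \<notin> A)) \<and> card {w \<in> W. r w \<notin> W} = 2"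
proof (rule exists_run[OF one _ ex(1,2)])
  fix p q assume pq: "p \<in> X" "q \<in> X" "(ed p \<in> A) \<noteq> (ed q \<in> A)"
  then have ne: "ed p \<noteq> ed q" by auto
  have "F {ed p} + F {ed q} \<ge> 3 \<and> F {ed p, ed q} \<noteq> 1"
    using rank_bound[OF one le _ _ ne] rank_bound[OF one le' _ _ ne] pq A
    by (auto split: if_splits)
  then show "(q, u q) \<in> (off (ed p))\<^sup>*"
    using pq ne by (intro not_interlaced[OF one]) auto
qed (use ex in auto)

text \<open>The run is found in a bouquet at \<open>T\<close>. Being closed under
  \<open>mk T\<close> and \<open>mk (- T)\<close> is the same as being closed under \<open>m\<close>
  and \<open>u\<close>, and \<open>r\<close> is unchanged, so it is a run here as well.\<close>

lemma exists_run_low_genus: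
  assumes conn: "\<And>p q. p \<in> X \<Longrightarrow> q \<in> X \<Longrightarrow> (p, q) \<in> (links X r \<union> links X m \<union> links X u)\<^sup>*"
    and le: "int (card (ed ` X)) + 2 - int (F {}) - int (F UNIV) \<le> 1"
    and le': "int (card (ed ` X)) + 2 - int (F A) - int (F (- A)) \<le> 1"
    and ex: "p0 \<in> X" "q0 \<in> X" "ed p0 \<in> A" "ed q0 \<notin> A"
  shows "\<exists>W\<subseteq>X. W \<noteq> {} \<and> (\<forall>w\<in>W. m w \<in> W \<and> u w \<in> W) \<and>
    ((\<forall>w\<in>W. ed w \<in> A) \<or> (\<forall>w\<in>W. ed w \<notin> A)) \<and> card {w \<in> W. r w \<notin> W} = 2"
proof -
  obtain T where T: "F T = 1" using exists_bouquet conn ex by blast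
  let ?F = "point_map.F X (mk T) (mk (- T)) r ed" and ?T' = "sym_diff T A"
  have "F (sym_diff T (ed ` X \<inter> T)) = F {}" "F (sym_diff T (ed ` X - T)) = F UNIV"
    "F (sym_diff T (ed ` X \<inter> ?T')) = F A" "F (sym_diff T (ed ` X - ?T')) = F (- A)"
    by (rule F_cong; auto)+
  then have "\<exists>W\<subseteq>X. W \<noteq> {} \<and> (\<forall>w\<in>W. mk T w \<in> W \<and> mk (- T) w \<in> W) \<and>
    ((\<forall>w\<in>W. ed w \<in> A) \<or> (\<forall>w\<in>W. ed w \<notin> A)) \<and> card {w \<in> W. r w \<notin> W} = 2"
    using T le le' ex
    by (intro point_map.exists_run_bouquet[OF point_map_mk, where T = T and T' = ?T']) (auto simp: F_mk)
  then obtain W where W: "W \<subseteq> X" "W \<noteq> {}" "\<forall>w\<in>W. mk T w \<in> W \<and> mk (- T) w \<in> W"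
    "(\<forall>w\<in>W. ed w \<in> A) \<or> (\<forall>w\<in>W. ed w \<notin> A)" "card {w \<in> W. r w \<notin> W} = 2" by blast
  have "m w \<in> W \<and> u w \<in> W" if "w \<in> W" for w
    using W(3) that by (cases "ed w \<in> T") (auto simp: mk_def)
  then show ?thesis using W by blast
qed

text \<open>The left-hand side is a sum of two ranks \<open>\<rho>\<close> in a bouquet.\<close>

lemma genus_nonneg:
  assumes conn: "\<And>p q. p \<in> X \<Longrightarrow> q \<in> X \<Longrightarrow> (p, q) \<in> (links X r \<union> links X m \<union> links X u)\<^sup>*"
    and "X \<noteq> {}"
  shows "int (card (ed ` X)) + 2 - int (F A) - int (F (- A)) \<ge> 0"
proof -
  obtain T where T: "F T = 1" using exists_bouquet conn assms(2) by blast
  let ?S = "ed ` X \<inter> sym_diff T A" and ?S' = "ed ` X - sym_diff T A"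
  have f: "finite ?S" "finite ?S'" using fin by auto
  have "F (sym_diff T ?S) = F A" "F (sym_diff T ?S') = F (- A)" by (rule F_cong; auto)+
  moreover have "int (card {}) - int (F (sym_diff T {})) \<le> int (card ?S) - int (F (sym_diff T ?S))"
    "int (card {}) - int (F (sym_diff T {})) \<le> int (card ?S') - int (F (sym_diff T ?S'))"
    using point_map.F_card_mono[OF point_map_mk f(1), of "{}" T]
      point_map.F_card_mono[OF point_map_mk f(2), of "{}" T] by (simp_all only: F_mk) auto
  moreover have "card (ed ` X) = card ?S + card ?S'"
    using card_Int_Diff[of "ed ` X" "sym_diff T A"] fin by simp
  ultimately show ?thesis using T by simp
qed

end

subsection \<open>Ribbon graphs\<close>

text \<open>\<open>orbit2\<close> follows its functions on the whole type; on a closed set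
  \<open>X\<close> it may be computed inside \<open>X\<close>.\<close>

lemma orbit2_eq:
  assumes "p \<in> X" "\<And>q. q \<in> X \<Longrightarrow> f q \<in> X" "\<And>q. q \<in> X \<Longrightarrow> g q \<in> X"
  shows "orbit2 f g p = (links X f \<union> links X g)\<^sup>* `` {p}"
proof
  let ?R = "links X f \<union> links X g"
  have X: "?R\<^sup>* `` {p} \<subseteq> X"
    by (rule class_subset[OF assms(1)]) (use assms(2,3) in \<open>auto simp: links_iff\<close>)
  show "orbit2 f g p \<subseteq> ?R\<^sup>* `` {p}" unfolding orbit2_def
  proof (rule class_subset)
    show "{(x, y). y = f x \<or> y = g x} `` (?R\<^sup>* `` {p}) \<subseteq> ?R\<^sup>* `` {p}"
    proof
      fix y assume "y \<in> {(x, y). y = f x \<or> y = g x} `` (?R\<^sup>* `` {p})"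
      then obtain x where x: "x \<in> ?R\<^sup>* `` {p}" "y = f x \<or> y = g x" by blast
      then have "x \<in> X" using X by blast
      then have "(x, y) \<in> ?R" using x(2) by (auto simp: links_iff)
      then show "y \<in> ?R\<^sup>* `` {p}" using x(1) by (simp del: Un_iff add: rtrancl_into_rtrancl)
    qed
  qed auto
  have "?R\<^sup>* \<subseteq> {(x, y). y = f x \<or> y = g x}\<^sup>*" by (rule rtrancl_mono) (auto simp: links_iff)
  then show "?R\<^sup>* `` {p} \<subseteq> orbit2 f g p" unfolding orbit2_def by auto
qed

lemma orbit2_subset: "p \<in> C \<Longrightarrow> (\<And>q. q \<in> C \<Longrightarrow> f q \<in> C) \<Longrightarrow> (\<And>q. q \<in> C \<Longrightarrow> g q \<in> C) \<Longrightarrow> orbit2 f g p \<subseteq> C"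
  unfolding orbit2_def by (rule class_subset) auto

lemma orbit2_refl: "p \<in> orbit2 f g p"
  and orbit2_left: "f p \<in> orbit2 f g p"
  and orbit2_right: "g p \<in> orbit2 f g p"
  by (auto simp: orbit2_def)

lemma ribbon_graphD:
  assumes "ribbon_graph G"
  shows "finite (verts G)" "finite (edges G)" "finite (pts G)"
    "p \<in> pts G \<Longrightarrow> vert_of G p \<in> verts G" "p \<in> pts G \<Longrightarrow> edge_of G p \<in> edges G"
    "fpf_involution_on (pts G) (seg G)" "fpf_involution_on (pts G) (side G)"
    "fpf_involution_on (pts G) (arc G)"
    "e \<in> edges G \<Longrightarrow> card {p \<in> pts G. edge_of G p = e} = 4"
    "p \<in> pts G \<Longrightarrow> orbit2 (seg G) (side G) p = {q \<in> pts G. edge_of G q = edge_of G p}"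
    "p \<in> pts G \<Longrightarrow> orbit2 (seg G) (arc G) p = {q \<in> pts G. vert_of G q = vert_of G p}"
  using assms by (simp_all add: ribbon_graph_def)

lemma ribbon_pts:
  assumes "ribbon_graph G" "p \<in> pts G"
  shows "seg G p \<in> pts G" "side G p \<in> pts G" "arc G p \<in> pts G"
    "seg G p \<noteq> p" "side G p \<noteq> p" "arc G p \<noteq> p"
    "seg G (seg G p) = p" "side G (side G p) = p" "arc G (arc G p) = p"
    "edge_of G (seg G p) = edge_of G p" "edge_of G (side G p) = edge_of G p"
    "vert_of G (seg G p) = vert_of G p" "vert_of G (arc G p) = vert_of G p"
  using ribbon_graphD(6,7,8)[OF assms(1)] ribbon_graphD(10,11)[OF assms] assms(2)
    orbit2_left[of "seg G" p "side G"] orbit2_right[of "side G" p "seg G"]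
    orbit2_left[of "seg G" p "arc G"] orbit2_right[of "arc G" p "seg G"]
  by (auto simp: fpf_involution_on_def)

lemma edges_eq: "ribbon_graph G \<Longrightarrow> edges G = edge_of G ` pts G"
proof
  assume G: "ribbon_graph G"
  show "edges G \<subseteq> edge_of G ` pts G"
  proof
    fix e assume "e \<in> edges G"
    then have "card {p \<in> pts G. edge_of G p = e} = 4" using ribbon_graphD(9)[OF G] by simp
    then have "{p \<in> pts G. edge_of G p = e} \<noteq> {}" by force
    then show "e \<in> edge_of G ` pts G" by auto
  qed
qed (use ribbon_graphD(5) in auto)

text \<open>An edge has four points forming one orbit, so a point, its images under
  \<open>seg G\<close> and \<open>side G\<close>, and \<open>seg G (side G p)\<close> exhaust it.
  The only place left for \<open>side G (seg G p)\<close> is the fourth one, so the involutions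
  commute.\<close>

lemma point_map_ribbon:
  assumes G: "ribbon_graph G"
  shows "point_map (pts G) (seg G) (side G) (arc G) (edge_of G)"
proof
  note P = ribbon_pts[OF G]
  show "finite (pts G)" "fpf_involution_on (pts G) (seg G)" "fpf_involution_on (pts G) (side G)"
    "fpf_involution_on (pts G) (arc G)" using ribbon_graphD[OF G] by auto
  fix p assume p: "p \<in> pts G"
  show "edge_of G (seg G p) = edge_of G p" "edge_of G (side G p) = edge_of G p" using P p by auto
  let ?O = "{q \<in> pts G. edge_of G q = edge_of G p}"
  have O: "orbit2 (seg G) (side G) p = ?O" using ribbon_graphD(10)[OF G p] .
  have card: "card ?O = 4" using ribbon_graphD(9)[OF G] ribbon_graphD(5)[OF G p] by simp
  have ne: "seg G p \<noteq> side G p"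
  proof
    assume e: "seg G p = side G p"
    have "?O \<subseteq> {p, seg G p}" unfolding O[symmetric]
      by (rule orbit2_subset) (use e P(7,8)[OF p] in \<open>metis insert_iff singletonD\<close>)+
    then have "card ?O \<le> card {p, seg G p}" by (intro card_mono) auto
    also have "\<dots> \<le> 2" by (simp add: card_insert_if)
    finally show False using card by simp
  qed
  let ?D = "{p, seg G p, side G p, seg G (side G p)}"
  have a: "seg G (side G p) \<noteq> p" using ne P p by metis
  have b: "seg G (side G p) \<noteq> seg G p" using P p by metis
  have c: "seg G (side G p) \<noteq> side G p" using P p by metis
  have "card ?D = 4" using a b c ne P(4)[OF p] P(5)[OF p] by (auto simp: card_insert_if)
  moreover have sub: "?D \<subseteq> ?O" using P p by auto
  moreover have "finite ?O" using ribbon_graphD(3)[OF G] by auto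
  ultimately have D: "?O = ?D" using card_subset_eq[of ?O ?D] card by simp
  show four: "seg G (side G p) \<noteq> p" by (rule a)
  have "side G (seg G p) \<in> ?D" unfolding D[symmetric] using P p by auto
  moreover have "side G (seg G p) \<noteq> p" using ne P p by metis
  moreover have "side G (seg G p) \<noteq> seg G p" using P p by metis
  moreover have "side G (seg G p) \<noteq> side G p" using P p by metis
  ultimately show "seg G (side G p) = side G (seg G p)" by auto
  fix q assume "q \<in> pts G" "edge_of G q = edge_of G p"
  then show "q \<in> {p, seg G p, side G p, seg G (side G p)}" using D by blast
qed

text \<open>The classes are the boundary components of \<open>(V(G), B)\<close> that are not isolated vertices.\<close>

definition face_rel :: "('v, 'e, 'p) ribbon_graph \<Rightarrow> 'e set \<Rightarrow> ('p \<times> 'p) set" where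
  "face_rel G B = links (pts G) (arc G) \<union> links (pts G) (marked G B)"

definition point_rel :: "('v, 'e, 'p) ribbon_graph \<Rightarrow> ('p \<times> 'p) set" where
  "point_rel G = links (pts G) (arc G) \<union> links (pts G) (seg G) \<union> links (pts G) (side G)"

lemma mk_marked: "ribbon_graph G \<Longrightarrow> point_map.mk (seg G) (side G) (edge_of G) B = marked G B"
  by (rule ext) (simp add: point_map.mk_def[OF point_map_ribbon] marked_def)

lemma rel_face_rel:
  "ribbon_graph G \<Longrightarrow> point_map.rel (pts G) (seg G) (side G) (arc G) (edge_of G) B = face_rel G B"
  by (simp add: point_map.rel_def[OF point_map_ribbon] face_rel_def mk_marked)

lemma F_face_rel:
  "ribbon_graph G \<Longrightarrow> point_map.F (pts G) (seg G) (side G) (arc G) (edge_of G) B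
    = num_classes (pts G) (face_rel G B)"
  by (simp add: point_map.F_def[OF point_map_ribbon] rel_face_rel)

lemma marked_pts:
  assumes "ribbon_graph G" "p \<in> pts G"
  shows "marked G B p \<in> pts G" "edge_of G (marked G B p) = edge_of G p"
  using ribbon_pts[OF assms] by (auto simp: marked_def)

text \<open>Closure of the involutions is assumed instead of \<open>ribbon_graph\<close> because
  \<open>euler_genus_connected\<close> applies this to a component before knowing it to be a ribbon
  graph.\<close>

lemma card_boundary_components:
  assumes "finite (pts G)" "finite (verts G)"
    and cl: "\<And>p. p \<in> pts G \<Longrightarrow> seg G p \<in> pts G \<and> side G p \<in> pts G \<and> arc G p \<in> pts G"
  shows "card (boundary_components G B) = num_classes (pts G) (face_rel G B) + card (isolated G)"
proof -
  have "orbit2 (marked G B) (arc G) p = (face_rel G B)\<^sup>* `` {p}" if "p \<in> pts G" for p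
    unfolding face_rel_def Un_commute[of "links (pts G) (arc G)"]
    by (rule orbit2_eq[OF that]) (use cl in \<open>auto simp: marked_def\<close>)
  then have "orbit2 (marked G B) (arc G) ` pts G = (\<lambda>p. (face_rel G B)\<^sup>* `` {p}) ` pts G"
    by (rule image_cong[OF refl])
  then have "card (orbit2 (marked G B) (arc G) ` pts G) = num_classes (pts G) (face_rel G B)"
    by (simp add: num_classes_def)
  moreover have "finite (isolated G)" using assms by (simp add: isolated_def)
  ultimately show ?thesis unfolding boundary_components_def using assms(1)
    by (subst card_Un_disjoint) (auto simp: card_image)
qed

lemma card_boundary_components_ribbon:
  "ribbon_graph G \<Longrightarrow>
    card (boundary_components G B) = num_classes (pts G) (face_rel G B) + card (isolated G)"
  by (rule card_boundary_components) (simp_all add: ribbon_graphD(1-3) ribbon_pts(1-3))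

lemma boundary_components_cong:
  assumes "ribbon_graph G" "B \<inter> edges G = B' \<inter> edges G"
  shows "card (boundary_components G B) = card (boundary_components G B')"
proof -
  have "num_classes (pts G) (face_rel G B) = num_classes (pts G) (face_rel G B')"
    using point_map.F_cong[OF point_map_ribbon[OF assms(1)], of B B'] assms
    by (simp add: F_face_rel edges_eq)
  then show ?thesis by (simp add: card_boundary_components_ribbon assms)
qed

text \<open>Without edges the boundary components are the boundaries of the vertex discs.\<close>

lemma card_verts:
  assumes G: "ribbon_graph G"
  shows "card (verts G) = card (boundary_components G {})"
proof -
  let ?f = "\<lambda>v. {q \<in> pts G. vert_of G q = v}"
  note D = ribbon_graphD[OF G]
  have m: "marked G {} = seg G" by (simp add: marked_def fun_eq_iff)
  have "orbit2 (marked G {}) (arc G) ` pts G = ?f ` vert_of G ` pts G"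
    unfolding m image_image by (rule image_cong[OF refl]) (use D(11) in auto)
  moreover have "inj_on ?f (vert_of G ` pts G)" by (rule inj_onI) blast
  ultimately have c: "card (orbit2 (marked G {}) (arc G) ` pts G) = card (vert_of G ` pts G)"
    by (simp add: card_image)
  have sub: "vert_of G ` pts G \<subseteq> verts G" using D(4) by auto
  have "card (verts G) = card (vert_of G ` pts G) + card (isolated G)"
    unfolding isolated_def using D(1,3) card_mono[OF _ sub]
    by (subst card_Diff_subset[OF _ sub]) auto
  also have "\<dots> = card (boundary_components G {})"
    unfolding boundary_components_def c[symmetric] using D
    by (subst card_Un_disjoint) (auto simp: card_image isolated_def)
  finally show ?thesis .
qed

text \<open>The Euler genus of \<open>G\<^sup>A\<close> for connected \<open>G\<close>.\<close>

definition dual_genus :: "('v, 'e, 'p) ribbon_graph \<Rightarrow> 'e set \<Rightarrow> int" where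
  "dual_genus G A = 2 + int (card (edges G)) - int (card (boundary_components G A))
     - int (card (boundary_components G (- A)))"

lemma dual_genus_empty:
  assumes "ribbon_graph G" shows "dual_genus G {} = 2 - euler_char G"
  using boundary_components_cong[OF assms, of UNIV "edges G"]
  by (simp add: dual_genus_def euler_char_def card_verts[OF assms])

lemma adjacency_verts:
  assumes "ribbon_graph G" "u \<in> verts G" shows "(adjacency G)\<^sup>* `` {u} \<subseteq> verts G"
  using assms ribbon_graphD(4)[OF assms(1)] ribbon_pts[OF assms(1)]
  by (intro class_subset) (auto simp: adjacency_def)

lemma subgraph_on_arc:
  "edge_of G (arc G p) \<in> E \<Longrightarrow> arc (subgraph_on G V E) p = arc G p"
  by (simp add: subgraph_on_def Least_eq_0)

text \<open>There is only one component, and the factor 2 for orientable components cancels the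
  division in \<open>genus\<close>, so both cases give 2 minus the Euler characteristic.\<close>

lemma euler_genus_connected:
  assumes G: "ribbon_graph G" and "rg_connected G"
  shows "euler_genus G = of_int (dual_genus G {})"
proof -
  note D = ribbon_graphD[OF G] and P = ribbon_pts[OF G]
  let ?C = "subgraph_on G (verts G) (edges G)"
  have q: "(adjacency G)\<^sup>* `` {u} = verts G" if "u \<in> verts G" for u
    using adjacency_verts[OF G that] assms(2) that by (auto simp: rg_connected_def)
  have "verts G // (adjacency G)\<^sup>* = {verts G}"
    using q assms(2) by (auto simp: quotient_def rg_connected_def)
  moreover have "{edge_of G p | p. p \<in> pts G \<and> vert_of G p \<in> verts G} = edges G"
    using edges_eq[OF G] D by auto
  ultimately have comp: "components G = {?C}" by (simp add: components_def)
  have C: "verts ?C = verts G" "edges ?C = edges G" "pts ?C = pts G" "seg ?C = seg G"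
    "side ?C = side G" "vert_of ?C = vert_of G" "edge_of ?C = edge_of G"
    using D by (auto simp: subgraph_on_def)
  \<comment> \<open>The component may differ from \<open>G\<close> as a record, since its
    \<open>arc\<close> is controlled only on \<open>pts G\<close>; therefore only the counts are
    compared.\<close>
  have arc: "arc ?C p = arc G p" if "p \<in> pts G" for p
    using that P D by (intro subgraph_on_arc) auto
  have "links (pts G) (arc ?C) = links (pts G) (arc G)" using arc by (auto simp: links_def)
  moreover have "marked ?C B = marked G B" for B using C by (auto simp: marked_def fun_eq_iff)
  moreover have "isolated ?C = isolated G" using C by (simp add: isolated_def)
  moreover have "card (boundary_components ?C B) = num_classes (pts ?C) (face_rel ?C B) + card (isolated ?C)" for B
    by (rule card_boundary_components) (use C D P arc in auto)
  ultimately have "card (boundary_components ?C B) = card (boundary_components G B)" for B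
    using C by (simp add: card_boundary_components_ribbon[OF G] face_rel_def)
  then have "euler_char ?C = euler_char G" by (simp add: euler_char_def C)
  then show ?thesis unfolding euler_genus_def comp dual_genus_empty[OF G]
    by (simp add: genus_def)
qed

text \<open>The points of a vertex form one orbit of \<open>seg G\<close> and \<open>arc G\<close>,
  and crossing a side is a step of \<open>adjacency G\<close>. Unlike adjacency,
  \<open>point_rel\<close> is invariant under partial duality.\<close>

lemma connected_iff:
  assumes G: "ribbon_graph G" and ne: "pts G \<noteq> {}"
  shows "rg_connected G \<longleftrightarrow> isolated G = {} \<and> (\<forall>p\<in>pts G. \<forall>q\<in>pts G. (p, q) \<in> (point_rel G)\<^sup>*)"
proof -
  note D = ribbon_graphD[OF G] and P = ribbon_pts[OF G]
  have same: "(p, q) \<in> (point_rel G)\<^sup>*" if "p \<in> pts G" "q \<in> pts G" "vert_of G p = vert_of G q" for p q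
  proof -
    have "q \<in> orbit2 (seg G) (arc G) p" using D(11) that by simp
    then have "(p, q) \<in> (links (pts G) (seg G) \<union> links (pts G) (arc G))\<^sup>*"
      using orbit2_eq[OF that(1), of "seg G" "arc G"] P by auto
    moreover have "(links (pts G) (seg G) \<union> links (pts G) (arc G))\<^sup>* \<subseteq> (point_rel G)\<^sup>*"
      by (rule rtrancl_mono) (auto simp: point_rel_def)
    ultimately show ?thesis by blast
  qed
  show ?thesis
  proof (intro iffI conjI ballI)
    assume con: "rg_connected G"
    show "isolated G = {}"
    proof (rule ccontr)
      assume "isolated G \<noteq> {}"
      then obtain v where v: "v \<in> verts G" "v \<notin> vert_of G ` pts G" by (auto simp: isolated_def)
      then have "(adjacency G)\<^sup>* `` {v} \<subseteq> {v}" by (intro class_subset) (auto simp: adjacency_def)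
      moreover obtain p where p: "p \<in> pts G" using ne by auto
      ultimately have "vert_of G p = v" using con v D(4) unfolding rg_connected_def by blast
      then show False using v p by auto
    qed
    have adj: "\<And>p q. p \<in> pts G \<Longrightarrow> q \<in> pts G \<Longrightarrow> a = vert_of G p \<Longrightarrow> b = vert_of G q \<Longrightarrow> (p, q) \<in> (point_rel G)\<^sup>*"
      if "(a, b) \<in> (adjacency G)\<^sup>*" for a b
      using that
    proof (induction rule: rtrancl_induct)
      case base then show ?case using same by simp
    next
      case (step b c)
      then obtain z where z: "z \<in> pts G" "b = vert_of G z" "c = vert_of G (side G z)"
        by (auto simp: adjacency_def)
      have "(p, z) \<in> (point_rel G)\<^sup>*" using step z by blast
      moreover have "(z, side G z) \<in> point_rel G" using z by (simp add: point_rel_def links_iff)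
      moreover have "(side G z, q) \<in> (point_rel G)\<^sup>*" using same step z P by simp
      ultimately show ?case by (meson rtrancl_into_rtrancl rtrancl_trans)
    qed
    fix p q assume "p \<in> pts G" "q \<in> pts G"
    then show "(p, q) \<in> (point_rel G)\<^sup>*" using adj con D(4) unfolding rg_connected_def by blast
  next
    assume h: "isolated G = {} \<and> (\<forall>p\<in>pts G. \<forall>q\<in>pts G. (p, q) \<in> (point_rel G)\<^sup>*)"
    have "(vert_of G p, vert_of G q) \<in> (adjacency G)\<^sup>*" if "(p, q) \<in> (point_rel G)\<^sup>*" for p q
      using that
    proof (induction rule: rtrancl_induct)
      case (step q z)
      then have q: "q \<in> pts G" and "z = arc G q \<or> z = seg G q \<or> z = side G q"
        by (auto simp: point_rel_def links_iff)
      then have "vert_of G z = vert_of G q \<or> (vert_of G q, vert_of G z) \<in> adjacency G"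
        using P by (auto simp: adjacency_def)
      then show ?case using step.IH by (auto intro: rtrancl_into_rtrancl)
    qed simp
    moreover have "verts G = vert_of G ` pts G" using h D(4) by (auto simp: isolated_def)
    ultimately show "rg_connected G" using h ne by (simp add: rg_connected_def)
  qed
qed

lemma connected_no_pts:
  assumes "pts G = {}"
  shows "rg_connected G \<longleftrightarrow> card (verts G) = 1"
proof -
  have "(adjacency G)\<^sup>* = Id" using assms by (simp add: adjacency_def)
  then have "rg_connected G \<longleftrightarrow> verts G \<noteq> {} \<and> (\<forall>u\<in>verts G. \<forall>w\<in>verts G. u = w)"
    by (simp add: rg_connected_def)
  then show ?thesis by (metis card_1_singletonE is_singletonI' is_singleton_altdef singletonD insert_not_empty)
qed

subsection \<open>Partial duals\<close>

lemma partial_dual_sel: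
  "verts (partial_dual G A) = boundary_components G A" "edges (partial_dual G A) = edges G"
  "pts (partial_dual G A) = pts G" "edge_of (partial_dual G A) = edge_of G"
  "vert_of (partial_dual G A) = (\<lambda>p. Inl (orbit2 (marked G A) (arc G) p))"
  "seg (partial_dual G A) = marked G A" "side (partial_dual G A) = marked G (- A)"
  "arc (partial_dual G A) = arc G"
  by (auto simp: partial_dual_def marked_def fun_eq_iff)

lemma marked_inv: "ribbon_graph G \<Longrightarrow> fpf_involution_on (pts G) (marked G A)"
  using point_map.mk_inv[OF point_map_ribbon, of G A] by (simp add: mk_marked)

lemma links_marked_Un: "links X (marked G A) \<union> links X (marked G (- A)) = links X (seg G) \<union> links X (side G)"
  by (auto simp: links_def marked_def split: if_splits)

lemma orbit2_cong_links:
  assumes "p \<in> X" "\<And>q. q \<in> X \<Longrightarrow> f q \<in> X" "\<And>q. q \<in> X \<Longrightarrow> g q \<in> X"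
    "\<And>q. q \<in> X \<Longrightarrow> f' q \<in> X" "\<And>q. q \<in> X \<Longrightarrow> g' q \<in> X"
    "links X f \<union> links X g = links X f' \<union> links X g'"
  shows "orbit2 f g p = orbit2 f' g' p"
  using orbit2_eq[of p X f g] orbit2_eq[of p X f' g'] assms by metis

lemma orbit_marked: "ribbon_graph G \<Longrightarrow> p \<in> pts G \<Longrightarrow> orbit2 (marked G A) (arc G) p = (face_rel G A)\<^sup>* `` {p}"
  unfolding face_rel_def Un_commute[of "links (pts G) (arc G)"]
  by (rule orbit2_eq) (auto simp: marked_pts ribbon_pts)

lemma sym_face_rel: "ribbon_graph G \<Longrightarrow> sym (face_rel G A)"
  unfolding face_rel_def by (intro sym_Un sym_links marked_inv ribbon_graphD)

text \<open>Exchanging \<open>seg G\<close> and \<open>side G\<close> on the edges in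
  \<open>A\<close> keeps the edge orbits, and the vertices of the dual are by definition the orbits
  of its segments and arcs.\<close>

lemma ribbon_partial_dual:
  assumes G: "ribbon_graph G" shows "ribbon_graph (partial_dual G A)"
proof -
  note D = ribbon_graphD[OF G] and P = ribbon_pts[OF G]
  have "finite (boundary_components G A)" using D by (simp add: boundary_components_def isolated_def)
  moreover have "orbit2 (marked G A) (marked G (- A)) p = {q \<in> pts G. edge_of G q = edge_of G p}"
    if "p \<in> pts G" for p
  proof -
    have "orbit2 (marked G A) (marked G (- A)) p = orbit2 (seg G) (side G) p"
      by (rule orbit2_cong_links[OF that _ _ _ _ links_marked_Un])
        (use marked_pts(1)[OF G] P(1,2) in blast)+
    then show ?thesis using D(10)[OF that] by simp
  qed
  moreover have "orbit2 (marked G A) (arc G) p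
      = {q \<in> pts G. orbit2 (marked G A) (arc G) q = orbit2 (marked G A) (arc G) p}" (is "?l = ?r")
    if p: "p \<in> pts G" for p
  proof (intro equalityI subsetI)
    fix q assume q: "q \<in> ?l"
    have "?l \<subseteq> pts G" by (rule orbit2_subset) (use p P(3) marked_pts(1)[OF G] in blast)+
    then have "q \<in> pts G" using q by blast
    then show "q \<in> ?r"
      using q class_eq[OF sym_face_rel[OF G], of p q A] by (simp add: orbit_marked[OF G] p)
  next
    fix q assume "q \<in> ?r" then show "q \<in> ?l" using orbit2_refl[of q] by auto
  qed
  ultimately show ?thesis
    unfolding ribbon_graph_def partial_dual_sel
    using D marked_inv[OF G] by (auto simp: boundary_components_def)
qed

lemma isolated_partial_dual: "isolated (partial_dual G A) = Inr ` isolated G"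
  by (auto simp: isolated_def partial_dual_sel boundary_components_def)

lemma connected_partial_dual:
  assumes G: "ribbon_graph G" and con: "rg_connected G"
  shows "rg_connected (partial_dual G A)"
proof (cases "pts G = {}")
  case True
  then have "isolated G = verts G" by (simp add: isolated_def)
  then have "boundary_components G A = Inr ` verts G" using True by (simp add: boundary_components_def)
  then show ?thesis using True con
    by (simp add: connected_no_pts partial_dual_sel card_image)
next
  case False
  have "point_rel (partial_dual G A) = point_rel G"
    unfolding point_rel_def partial_dual_sel Un_assoc links_marked_Un ..
  then show ?thesis using con False
    by (simp add: connected_iff[OF G False] connected_iff[OF ribbon_partial_dual[OF G]]
        partial_dual_sel isolated_partial_dual)
qed

text \<open>The vertices of the dual are the circles for \<open>A\<close>, and its boundary
  components are those for the complement.\<close>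

lemma dual_genus_partial_dual:
  assumes G: "ribbon_graph G"
  shows "dual_genus (partial_dual G A) {} = dual_genus G A"
proof -
  have "marked (partial_dual G A) {} = marked G A" "marked (partial_dual G A) UNIV = marked G (- A)"
    by (auto simp: marked_def partial_dual_sel fun_eq_iff)
  then have "card (boundary_components (partial_dual G A) {}) = card (boundary_components G A)"
    "card (boundary_components (partial_dual G A) UNIV) = card (boundary_components G (- A))"
    by (simp_all add: card_boundary_components_ribbon[OF G]
        card_boundary_components_ribbon[OF ribbon_partial_dual[OF G]] face_rel_def partial_dual_sel
        isolated_partial_dual card_image)
  then show ?thesis by (simp add: dual_genus_def partial_dual_sel)
qed

lemma dual_genus_nonneg:
  assumes G: "ribbon_graph G" and con: "rg_connected G"
  shows "dual_genus G A \<ge> 0"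
proof (cases "pts G = {}")
  case True
  then have "isolated G = verts G" by (simp add: isolated_def)
  then have "boundary_components G B = Inr ` verts G" for B using True by (simp add: boundary_components_def)
  moreover have "edges G = {}" using True edges_eq[OF G] by simp
  ultimately show ?thesis using con True by (simp add: dual_genus_def connected_no_pts card_image)
next
  case False
  then have c: "isolated G = {}" "\<And>p q. p \<in> pts G \<Longrightarrow> q \<in> pts G \<Longrightarrow> (p, q) \<in> (point_rel G)\<^sup>*"
    using con connected_iff[OF G] by auto
  show ?thesis
    using point_map.genus_nonneg[OF point_map_ribbon[OF G] c(2)[unfolded point_rel_def] False, of A]
    by (simp add: dual_genus_def card_boundary_components_ribbon[OF G] F_face_rel[OF G] c(1) edges_eq[OF G])
qed

text \<open>When all edges are on one side of \<open>A\<close>, the two counts are those for no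
  edges and for all edges, in some order.\<close>

lemma dual_genus_cong:
  assumes G: "ribbon_graph G" and "edges G \<subseteq> A \<or> edges G \<inter> A = {}"
  shows "dual_genus G A = dual_genus G {}"
  using assms(2)
proof
  assume "edges G \<subseteq> A"
  then have "card (boundary_components G A) = card (boundary_components G UNIV)"
    "card (boundary_components G (- A)) = card (boundary_components G {})"
    by (auto intro!: boundary_components_cong[OF G])
  then show ?thesis by (simp add: dual_genus_def)
next
  assume "edges G \<inter> A = {}"
  then have "card (boundary_components G A) = card (boundary_components G {})"
    "card (boundary_components G (- A)) = card (boundary_components G UNIV)"
    by (auto intro!: boundary_components_cong[OF G])
  then show ?thesis by (simp add: dual_genus_def)
qed

subsection \<open>Cutting at two arcs\<close>

text \<open>On a circle alternating between \<open>f\<close> and \<open>g\<close>, an even number of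
  links starting with \<open>g\<close> never leads to \<open>g z\<close>. An equation for
  \<open>n + 2\<close> rounds gives one for \<open>n\<close> rounds from \<open>f (g z)\<close>, and
  for 0 or 1 rounds it would be a fixed point of \<open>g\<close> or \<open>f\<close>.\<close>

lemma funpow_involutions_neq:
  assumes f: "fpf_involution_on X f" and g: "fpf_involution_on X g" and "z \<in> X"
  shows "((f \<circ> g) ^^ j) z \<noteq> g z"
  using \<open>z \<in> X\<close>
proof (induction j arbitrary: z rule: induct_nat_012)
  case 0
  then show ?case using g by (metis fpf_involution_on_def funpow_0)
next
  case 1
  then have "g z \<in> X" using g by (simp add: fpf_involution_on_def)
  then show ?case using f by (simp add: fpf_involution_on_def)
next
  case (ge2 n)
  define w where "w = f (g z)"
  have w: "w \<in> X" "g z = f w" using ge2.prems f g by (auto simp: fpf_involution_on_def w_def)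
  have "((f \<circ> g) ^^ n) w \<in> X" by (induction n) (use w f g in \<open>auto simp: fpf_involution_on_def\<close>)
  then have v: "g (((f \<circ> g) ^^ n) w) \<in> X" "g (g (((f \<circ> g) ^^ n) w)) = ((f \<circ> g) ^^ n) w"
    using g by (auto simp: fpf_involution_on_def)
  have "((f \<circ> g) ^^ Suc n) z = ((f \<circ> g) ^^ n) w"
    by (simp only: funpow_Suc_right o_apply w_def)
  then have eq: "((f \<circ> g) ^^ Suc (Suc n)) z = f (g (((f \<circ> g) ^^ n) w))" by simp
  show ?case
  proof
    assume "((f \<circ> g) ^^ Suc (Suc n)) z = g z"
    then have "f (g (((f \<circ> g) ^^ n) w)) = f w" using w eq by simp
    then have "g (((f \<circ> g) ^^ n) w) = w" using f v(1) w(1) by (metis fpf_involution_on_def)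
    then have "((f \<circ> g) ^^ n) w = g w" using v(2) by simp
    then show False using ge2.IH(1)[OF w(1)] by simp
  qed
qed

lemma next_seg_eq: "next_seg G = arc G \<circ> seg G"
  by (auto simp: next_seg_def)

lemma next_seg_pts:
  assumes "ribbon_graph G" "p \<in> pts G"
  shows "(next_seg G ^^ i) p \<in> pts G" "vert_of G ((next_seg G ^^ i) p) = vert_of G p"
  by (induction i) (use assms ribbon_pts[OF assms(1)] in \<open>auto simp: next_seg_def\<close>)

text \<open>The walk round the vertex starts at \<open>a\<close>, away from the arc leaving
  \<open>Y\<close> there. It must leave \<open>Y\<close> again, and this can only happen at
  \<open>b\<close>.\<close>

lemma arc_exit:
  assumes G: "ribbon_graph G" and Y: "Y \<subseteq> pts G" and segY: "\<And>y. y \<in> Y \<Longrightarrow> seg G y \<in> Y"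
    and ab: "{y \<in> Y. arc G y \<notin> Y} = {a, b}"
  obtains n where "n > 0" "\<And>i. i < n \<Longrightarrow> (next_seg G ^^ i) a \<in> Y"
    "seg G ((next_seg G ^^ (n - 1)) a) = b" "(next_seg G ^^ n) a = arc G b"
proof -
  note P = ribbon_pts[OF G]
  let ?w = "\<lambda>i. (next_seg G ^^ i) a"
  have a: "a \<in> Y" "arc G a \<notin> Y" using ab by auto
  have "\<exists>n. ?w n \<notin> Y"
  proof (rule ccontr)
    assume "\<not> ?thesis"
    then have I: "range ?w \<subseteq> Y" by auto
    have "finite (range ?w)" using I Y ribbon_graphD(3)[OF G] by (meson finite_subset)
    moreover have "next_seg G ` range ?w \<subseteq> range ?w"
    proof
      fix x assume "x \<in> next_seg G ` range ?w"
      then obtain i where "x = next_seg G (?w i)" by auto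
      then have "x = ?w (Suc i)" by simp
      then show "x \<in> range ?w" by blast
    qed
    \<comment> \<open>A walk confined to \<open>Y\<close> would be permuted by
      \<open>next_seg G\<close>, so \<open>a\<close> would have a predecessor \<open>i\<close> on it
      and \<open>arc G a = seg G i\<close> would lie in \<open>Y\<close>.\<close>
    moreover have "inj_on (next_seg G) (range ?w)"
    proof (rule inj_onI)
      fix x y assume xy: "x \<in> range ?w" "y \<in> range ?w" "next_seg G x = next_seg G y"
      then have "x \<in> pts G" "y \<in> pts G" using I Y by auto
      then show "x = y" using xy(3) P unfolding next_seg_def by metis
    qed
    ultimately have "next_seg G ` range ?w = range ?w" by (rule endo_inj_surj)
    moreover have "a \<in> range ?w" by (rule range_eqI[of _ _ 0]) simp
    ultimately obtain i where i: "i \<in> range ?w" "a = next_seg G i" by blast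
    then have "i \<in> Y" using I by auto
    then have "seg G i \<in> pts G" using Y segY by blast
    then have "arc G a = seg G i" using i(2) P(9) by (simp add: next_seg_def)
    then show False using a segY \<open>i \<in> Y\<close> by auto
  qed
  then obtain n where n: "?w n \<notin> Y" and "\<forall>i<n. ?w i \<in> Y"
    using exists_least_iff[where P = "\<lambda>n. ?w n \<notin> Y"] by auto
  then have min: "?w i \<in> Y" if "i < n" for i using that by blast
  have "n > 0" using n a by (cases n) auto
  then obtain m where m: "n = Suc m" using gr0_conv_Suc by auto
  have w: "?w m \<in> Y" "seg G (?w m) \<in> Y" using min m segY by auto
  moreover have wn: "arc G (seg G (?w m)) = ?w n" using m by (simp add: next_seg_def)
  ultimately have "seg G (?w m) \<in> {y \<in> Y. arc G y \<notin> Y}" using n by simp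
  then have "seg G (?w m) \<in> {a, b}" unfolding ab .
  \<comment> \<open>Parity of the walk excludes leaving through \<open>a\<close> itself.\<close>
  moreover have "seg G (?w m) \<noteq> a"
  proof
    assume h: "seg G (?w m) = a"
    have "?w m \<in> pts G" using w(1) Y by blast
    from P(7)[OF this] have "?w m = seg G a" unfolding h by (rule sym)
    then show False
      using funpow_involutions_neq[OF ribbon_graphD(8,6)[OF G], of a m] a(1) Y
      by (metis next_seg_eq subsetD)
  qed
  ultimately have "seg G (?w m) = b" by auto
  then show thesis using that[of n] \<open>n > 0\<close> min m wn by simp
qed

section \<open>Two-cuts and the parts they separate\<close>

definition epts :: "('v, 'e, 'p) ribbon_graph \<Rightarrow> 'e set \<Rightarrow> 'p set" where
  "epts G Q = {p \<in> pts G. edge_of G p \<in> Q}"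

text \<open>\<open>a\<close> and \<open>b\<close> are the ends in \<open>Q\<close> of the only two arcs between \<open>Q\<close> and the other edges.\<close>

definition two_cut :: "('v, 'e, 'p) ribbon_graph \<Rightarrow> 'e set \<Rightarrow> 'p \<Rightarrow> 'p \<Rightarrow> bool" where
  "two_cut G Q a b \<longleftrightarrow> Q \<subseteq> edges G \<and> a \<noteq> b \<and> {y \<in> epts G Q. arc G y \<notin> epts G Q} = {a, b}"

lemma epts_closed:
  assumes "ribbon_graph G" "y \<in> epts G Q"
  shows "y \<in> pts G" "seg G y \<in> epts G Q" "side G y \<in> epts G Q" "marked G B y \<in> epts G Q"
    "arc G y \<in> pts G"
  using assms ribbon_pts[OF assms(1)] marked_pts[OF assms(1)] by (auto simp: epts_def)

lemma epts_Diff: "ribbon_graph G \<Longrightarrow> epts G (edges G - Q) = pts G - epts G Q"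
  using ribbon_graphD(5) by (fastforce simp: epts_def)

lemma two_cut_sym: "two_cut G Q a b \<Longrightarrow> two_cut G Q b a"
  by (auto simp: two_cut_def)

lemma two_cutD:
  assumes "two_cut G Q a b"
  shows "Q \<subseteq> edges G" "a \<noteq> b" "a \<in> epts G Q" "b \<in> epts G Q" "arc G a \<notin> epts G Q" "arc G b \<notin> epts G Q"
    "y \<in> epts G Q \<Longrightarrow> y \<noteq> a \<Longrightarrow> y \<noteq> b \<Longrightarrow> arc G y \<in> epts G Q"
proof -
  have "{y \<in> epts G Q. arc G y \<notin> epts G Q} = {a, b}" using assms by (simp add: two_cut_def)
  then have *: "y \<in> epts G Q \<and> arc G y \<notin> epts G Q \<longleftrightarrow> y = a \<or> y = b" for y by blast
  show "Q \<subseteq> edges G" "a \<noteq> b" using assms by (auto simp: two_cut_def)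
  show "a \<in> epts G Q" "b \<in> epts G Q" "arc G a \<notin> epts G Q" "arc G b \<notin> epts G Q" using * by auto
  show "y \<in> epts G Q \<Longrightarrow> y \<noteq> a \<Longrightarrow> y \<noteq> b \<Longrightarrow> arc G y \<in> epts G Q" using * by auto
qed

lemma two_cut_compl:
  assumes G: "ribbon_graph G" and cut: "two_cut G Q a b"
  shows "two_cut G (edges G - Q) (arc G a) (arc G b)"
proof -
  note P = ribbon_pts[OF G] and C = two_cutD[OF cut] and E = epts_closed[OF G]
  have ab: "a \<in> pts G" "b \<in> pts G" using C E by auto
  have "{y \<in> pts G - epts G Q. arc G y \<notin> pts G - epts G Q} = {arc G a, arc G b}"
  proof (intro equalityI subsetI)
    fix y assume y: "y \<in> {y \<in> pts G - epts G Q. arc G y \<notin> pts G - epts G Q}"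
    then have y1: "y \<in> pts G" "y \<notin> epts G Q" "arc G y \<in> epts G Q" "arc G (arc G y) = y" using P by auto
    then have "arc G y = a \<or> arc G y = b" using C(7)[of "arc G y"] by auto
    then show "y \<in> {arc G a, arc G b}" using y1 by auto
  qed (use C P ab in auto)
  moreover have "arc G a \<noteq> arc G b" using C(2) P ab by metis
  ultimately show ?thesis by (simp add: two_cut_def epts_Diff[OF G])
qed

lemma subgraph_on_sel:
  "verts (subgraph_on G V Q) = V" "edges (subgraph_on G V Q) = Q" "pts (subgraph_on G V Q) = epts G Q"
  "vert_of (subgraph_on G V Q) = vert_of G" "edge_of (subgraph_on G V Q) = edge_of G"
  "seg (subgraph_on G V Q) = seg G" "side (subgraph_on G V Q) = side G"
  "marked (subgraph_on G V Q) = marked G"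
  by (auto simp: subgraph_on_def epts_def marked_def fun_eq_iff)

lemma subgraph_arc_other:
  assumes "two_cut G Q a b" "y \<in> epts G Q" "y \<noteq> a" "y \<noteq> b"
  shows "arc (subgraph_on G V Q) y = arc G y"
  by (rule subgraph_on_arc) (use two_cutD(7)[OF assms] in \<open>simp add: epts_def\<close>)

text \<open>The free arc of the subgraph from \<open>a\<close> runs through the deleted segments
  until it meets \<open>Q\<close> again; by \<open>arc_exit\<close> for the complement this is at
  \<open>b\<close>.\<close>

lemma subgraph_arc_cut:
  assumes G: "ribbon_graph G" and cut: "two_cut G Q a b"
  shows "arc (subgraph_on G V Q) a = b"
proof -
  let ?Y = "epts G (edges G - Q)"
  note cut' = two_cut_compl[OF G cut]
  have b: "b \<in> epts G Q" using two_cutD[OF cut] by auto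
  then have bb: "arc G (arc G b) = b" using epts_closed[OF G b] ribbon_pts[OF G] by auto
  obtain n where n: "n > 0" "\<And>i. i < n \<Longrightarrow> (next_seg G ^^ i) (arc G a) \<in> ?Y"
    "(next_seg G ^^ n) (arc G a) = arc G (arc G b)"
    by (rule arc_exit[OF G, where Y = "?Y" and a = "arc G a" and b = "arc G b"])
      (use cut' epts_closed[OF G] in \<open>auto simp: two_cut_def\<close>)
  have "(LEAST n. edge_of G ((next_seg G ^^ n) (arc G a)) \<in> Q) = n"
  proof (rule Least_equality)
    show "edge_of G ((next_seg G ^^ n) (arc G a)) \<in> Q" using n bb b by (simp add: epts_def)
    fix i assume "edge_of G ((next_seg G ^^ i) (arc G a)) \<in> Q"
    then show "n \<le> i" using n(2)[of i] by (auto simp: epts_def not_less[symmetric])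
  qed
  then show ?thesis using n bb by (simp add: subgraph_on_def)
qed

lemma subgraph_arc_cases:
  assumes G: "ribbon_graph G" and cut: "two_cut G Q a b" and "y \<in> epts G Q"
  shows "arc (subgraph_on G V Q) y = (if y = a then b else if y = b then a else arc G y)"
  using subgraph_arc_other[OF cut assms(3)] subgraph_arc_cut[OF G cut]
    subgraph_arc_cut[OF G two_cut_sym[OF cut]] by simp

lemma subgraph_arc_inv:
  assumes G: "ribbon_graph G" and cut: "two_cut G Q a b"
  shows "fpf_involution_on (epts G Q) (arc (subgraph_on G V Q))"
  unfolding fpf_involution_on_def
proof
  fix y assume y: "y \<in> epts G Q"
  note C = two_cutD[OF cut] and P = ribbon_pts[OF G epts_closed(1)[OF G y]]
  note ac = subgraph_arc_cases[OF G cut]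
  show "arc (subgraph_on G V Q) y \<in> epts G Q \<and> arc (subgraph_on G V Q) y \<noteq> y \<and>
    arc (subgraph_on G V Q) (arc (subgraph_on G V Q) y) = y"
  proof (cases "y = a \<or> y = b")
    case True
    then show ?thesis using ac[OF C(3)] ac[OF C(4)] C(2-4) by auto
  next
    case False
    then have z: "arc G y \<in> epts G Q" using C(7)[of y] y by blast
    have "arc G y \<noteq> a" "arc G y \<noteq> b" using P(9) C(5,6) y by auto
    then show ?thesis using ac[OF y] ac[OF z] False z P by simp
  qed
qed

text \<open>An excursion into the other edges leaves and returns through \<open>a\<close> or
  \<open>b\<close>, so the new arc between these replaces it. \<open>M\<close> is general because it
  consists of the segments for vertex orbits, but of segments and sides for connectedness.\<close>

lemma subgraph_reachable:
  assumes G: "ribbon_graph G" and cut: "two_cut G Q a b"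
    and M: "\<And>x y. (x, y) \<in> M \<Longrightarrow> x \<in> pts G \<and> y \<in> pts G \<and> (x \<in> epts G Q \<longleftrightarrow> y \<in> epts G Q)"
    and pq: "p \<in> epts G Q" "q \<in> epts G Q" "(p, q) \<in> (links (pts G) (arc G) \<union> M)\<^sup>*"
  shows "(p, q) \<in> (links (epts G Q) (arc (subgraph_on G V Q)) \<union> M \<inter> epts G Q \<times> epts G Q)\<^sup>*"
proof -
  let ?Y = "epts G Q" and ?h = "arc (subgraph_on G V Q)"
  let ?R = "links ?Y ?h \<union> M \<inter> ?Y \<times> ?Y"
  define C where "C = ?R\<^sup>* `` {p}"
  define D where "D = C \<union> (if a \<in> C \<or> b \<in> C then pts G - ?Y else {})"
  note P = ribbon_pts[OF G] and T = two_cutD[OF cut]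
  have h: "?h y \<in> ?Y" if "y \<in> ?Y" for y
    using subgraph_arc_inv[OF G cut] that by (simp add: fpf_involution_on_def)
  have CY: "C \<subseteq> ?Y" unfolding C_def
  proof (rule class_subset[OF pq(1)], rule subsetI)
    fix y assume "y \<in> ?R `` ?Y"
    then obtain x where "x \<in> ?Y" "y = ?h x \<or> y \<in> ?Y" by (auto simp: links_iff)
    then show "y \<in> ?Y" using h by blast
  qed
  have Cstep: "y \<in> C" if "x \<in> C" "(x, y) \<in> ?R" for x y
    using that unfolding C_def by (simp add: rtrancl_into_rtrancl del: Un_iff)
  have Ch: "?h x \<in> C" if "x \<in> C" for x
    using Cstep[OF that, of "?h x"] CY that by (auto simp: links_iff)
  have ab: "a \<in> C \<longleftrightarrow> b \<in> C"
    using Ch[of a] Ch[of b] subgraph_arc_cut[OF G cut] subgraph_arc_cut[OF G two_cut_sym[OF cut]]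
    by auto
  have "(links (pts G) (arc G) \<union> M)\<^sup>* `` {p} \<subseteq> D"
  proof (rule class_subset)
    show "p \<in> D" by (auto simp: D_def C_def)
    show "(links (pts G) (arc G) \<union> M) `` D \<subseteq> D"
    proof
      fix y assume "y \<in> (links (pts G) (arc G) \<union> M) `` D"
      then obtain x where x: "x \<in> D" "(x, y) \<in> links (pts G) (arc G) \<or> (x, y) \<in> M" by blast
      show "y \<in> D" using x(2)
      proof
        assume "(x, y) \<in> links (pts G) (arc G)"
        then have y: "y = arc G x" "x \<in> pts G" by (auto simp: links_iff)
        show ?thesis
        proof (cases "x \<in> C")
          case True
          then have xY: "x \<in> ?Y" using CY by auto
          note inC = True
          show ?thesis
          proof (cases "x = a \<or> x = b")
            case True
            then have "y \<in> pts G - ?Y" using y P T by auto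
            then show ?thesis using True inC by (auto simp: D_def)
          next
            case False
            then have "?h x = y" using subgraph_arc_other[OF cut xY] y by simp
            then show ?thesis using Ch[OF inC] by (simp add: D_def)
          qed
        next
          case False
          then have xD: "x \<in> pts G - ?Y" "a \<in> C" "b \<in> C" using x(1) ab by (auto simp: D_def split: if_splits)
          show ?thesis
          proof (cases "y \<in> ?Y")
            case True
            then have "y = a \<or> y = b" using T(7)[of y] y P xD by auto
            then show ?thesis using xD by (auto simp: D_def)
          qed (use y P xD in \<open>auto simp: D_def\<close>)
        qed
      next
        assume m: "(x, y) \<in> M"
        then have "x \<in> pts G" "y \<in> pts G" "x \<in> ?Y \<longleftrightarrow> y \<in> ?Y" using M by auto
        then show ?thesis using x(1) Cstep[of x y] m CY by (auto simp: D_def split: if_splits)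
      qed
    qed
  qed
  then have "q \<in> D" using pq by blast
  then show ?thesis using pq by (auto simp: D_def C_def split: if_splits)
qed

text \<open>By \<open>arc_exit\<close> the points \<open>a\<close> and \<open>b\<close> lie at the
  same vertex, so the new arc stays at that vertex; \<open>subgraph_reachable\<close> shows that
  each vertex boundary remains a single circle.\<close>

lemma ribbon_subgraph_cut:
  assumes G: "ribbon_graph G" and cut: "two_cut G Q a b"
    and V: "finite V" "vert_of G ` epts G Q \<subseteq> V"
  shows "ribbon_graph (subgraph_on G V Q)"
proof -
  let ?H = "subgraph_on G V Q" and ?Y = "epts G Q"
  note D = ribbon_graphD[OF G] and P = ribbon_pts[OF G] and E = epts_closed[OF G] and T = two_cutD[OF cut]
  have hinv: "fpf_involution_on ?Y (arc ?H)" by (rule subgraph_arc_inv[OF G cut])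
  have h: "arc ?H y \<in> ?Y" if "y \<in> ?Y" for y using hinv that by (simp add: fpf_involution_on_def)
  have 1: "orbit2 (seg G) (side G) p = {q \<in> ?Y. edge_of G q = edge_of G p}" if "p \<in> ?Y" for p
    using D(10)[OF E(1)[OF that]] that by (auto simp: epts_def)
  have same: "vert_of G a = vert_of G b"
  proof -
    have c: "arc G a \<in> epts G (edges G - Q)" "arc G b \<in> epts G (edges G - Q)"
      using two_cutD[OF two_cut_compl[OF G cut]] by auto
    obtain n where "(next_seg G ^^ n) (arc G a) = arc G (arc G b)"
      by (rule arc_exit[OF G, where Y = "epts G (edges G - Q)" and a = "arc G a" and b = "arc G b"])
        (use two_cut_compl[OF G cut] E in \<open>auto simp: two_cut_def\<close>)
    then have "vert_of G (arc G a) = vert_of G (arc G (arc G b))"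
      using next_seg_pts(2)[OF G E(1)[OF c(1)], of n] by simp
    then show ?thesis using P E T by simp
  qed
  have hv: "vert_of G (arc ?H y) = vert_of G y" if "y \<in> ?Y" for y
    using subgraph_arc_cases[OF G cut that] same P(13)[OF E(1)[OF that]] by auto
  have 2: "orbit2 (seg G) (arc ?H) p = {q \<in> ?Y. vert_of G q = vert_of G p}" (is "?l = ?r") if p: "p \<in> ?Y" for p
  proof
    show "?l \<subseteq> ?r"
      by (rule orbit2_subset) (use p h hv E P in auto)
    show "?r \<subseteq> ?l"
    proof
      fix q assume "q \<in> ?r"
      then have q: "q \<in> ?Y" "vert_of G q = vert_of G p" by auto
      have eq: "orbit2 (seg G) (arc G) p = (links (pts G) (seg G) \<union> links (pts G) (arc G))\<^sup>* `` {p}"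
        by (rule orbit2_eq) (use P E p in auto)
      have "q \<in> orbit2 (seg G) (arc G) p" using D(11) E(1) p q by simp
      then have "(p, q) \<in> (links (pts G) (arc G) \<union> links (pts G) (seg G))\<^sup>*"
        unfolding eq by (simp add: Un_commute)
      then have "(p, q) \<in> (links ?Y (arc ?H) \<union> links (pts G) (seg G) \<inter> ?Y \<times> ?Y)\<^sup>*"
        by (rule subgraph_reachable[OF G cut _ p q(1), rotated]) (use P in \<open>auto simp: links_iff epts_def\<close>)
      moreover have "links (pts G) (seg G) \<inter> ?Y \<times> ?Y \<subseteq> links ?Y (seg G)"
        by (auto simp: links_iff)
      then have "(links ?Y (arc ?H) \<union> links (pts G) (seg G) \<inter> ?Y \<times> ?Y)\<^sup>*
          \<subseteq> (links ?Y (seg G) \<union> links ?Y (arc ?H))\<^sup>*" by (intro rtrancl_mono) blast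
      ultimately have "(p, q) \<in> (links ?Y (seg G) \<union> links ?Y (arc ?H))\<^sup>*" by blast
      moreover have "?l = (links ?Y (seg G) \<union> links ?Y (arc ?H))\<^sup>* `` {p}"
        by (rule orbit2_eq) (use h E p in auto)
      ultimately show "q \<in> ?l" by simp
    qed
  qed
  have 3: "card {p \<in> ?Y. edge_of G p = e} = 4" if "e \<in> Q" for e
  proof -
    have "{p \<in> ?Y. edge_of G p = e} = {p \<in> pts G. edge_of G p = e}" using that by (auto simp: epts_def)
    then show ?thesis using D(9) T(1) that by auto
  qed
  have "finite ?Y" "finite Q" using D(2,3) T(1) by (auto simp: epts_def finite_subset)
  moreover have "fpf_involution_on ?Y (seg G)" "fpf_involution_on ?Y (side G)"
    using P E by (auto simp: fpf_involution_on_def)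
  moreover have "edge_of G y \<in> Q" if "y \<in> ?Y" for y using that by (simp add: epts_def)
  ultimately show ?thesis
    unfolding ribbon_graph_def subgraph_on_sel using hinv 1 2 3 V by blast
qed

lemma connected_subgraph_cut:
  assumes G: "ribbon_graph G" and con: "rg_connected G" and cut: "two_cut G Q a b"
  shows "rg_connected (subgraph_on G (vert_of G ` epts G Q) Q)"
proof -
  let ?Y = "epts G Q" and ?H = "subgraph_on G (vert_of G ` epts G Q) Q"
  note P = ribbon_pts[OF G] and E = epts_closed[OF G] and T = two_cutD[OF cut]
  have fin: "finite (vert_of G ` ?Y)" using ribbon_graphD(3)[OF G] by (simp add: epts_def)
  have H: "ribbon_graph ?H" by (rule ribbon_subgraph_cut[OF G cut fin]) auto
  have ne: "pts ?H \<noteq> {}" "pts G \<noteq> {}" using T(3) E(1) by (auto simp: subgraph_on_sel)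
  have "(p, q) \<in> (point_rel ?H)\<^sup>*" if pq: "p \<in> ?Y" "q \<in> ?Y" for p q
  proof -
    let ?M = "links (pts G) (seg G) \<union> links (pts G) (side G)"
    have "(p, q) \<in> (links (pts G) (arc G) \<union> ?M)\<^sup>*"
      using con connected_iff[OF G ne(2)] pq E(1) unfolding point_rel_def Un_assoc by blast
    then have "(p, q) \<in> (links ?Y (arc ?H) \<union> ?M \<inter> ?Y \<times> ?Y)\<^sup>*"
      by (rule subgraph_reachable[OF G cut _ pq, rotated]) (use P in \<open>auto simp: links_iff epts_def\<close>)
    moreover have "links ?Y (arc ?H) \<union> ?M \<inter> ?Y \<times> ?Y \<subseteq> point_rel ?H"
      by (auto simp: point_rel_def links_iff subgraph_on_sel)
    ultimately show ?thesis using rtrancl_mono by blast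
  qed
  moreover have "isolated ?H = {}" by (simp add: isolated_def subgraph_on_sel)
  ultimately show ?thesis unfolding connected_iff[OF H ne(1)] by (simp add: subgraph_on_sel)
qed

text \<open>Opening the two cut arcs leaves a path from \<open>a\<close> to \<open>b\<close> inside
  \<open>Q\<close> and one from \<open>arc G a\<close> to \<open>arc G b\<close> outside. In
  \<open>G\<close> they form one circle together, in the two parts one circle each; the other
  circles agree.\<close>

lemma num_faces_cut:
  assumes G: "ribbon_graph G" and cut: "two_cut G Q a b"
  shows "num_classes (pts G) (face_rel G B) + 1 =
    num_classes (epts G (edges G - Q)) (face_rel (subgraph_on G V (edges G - Q)) B) +
    num_classes (epts G Q) (face_rel (subgraph_on G V' Q) B)"
proof -
  let ?Q' = "edges G - Q"
  let ?X = "pts G" and ?Y = "epts G Q" and ?Y' = "epts G ?Q'" and ?m = "marked G B"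
  let ?H = "subgraph_on G V' Q" and ?H' = "subgraph_on G V ?Q'"
  note P = ribbon_pts[OF G] and E = epts_closed[OF G] and T = two_cutD[OF cut] and D = ribbon_graphD[OF G]
  note cut' = two_cut_compl[OF G cut]
  define c d where "c = arc G a" and "d = arc G b"
  have cut'': "two_cut G ?Q' c d" using cut' by (simp add: c_def d_def)
  note T' = two_cutD[OF cut'']
  define Z where "Z = {a, b, c, d}"
  define R where "R = links ?X ?m \<union> links (?X - Z) (arc G)"
  have Y': "?Y' = ?X - ?Y" by (rule epts_Diff[OF G])
  have ptsZ: "a \<in> ?X" "b \<in> ?X" "c \<in> ?X" "d \<in> ?X" using T(3,4) T'(3,4) E(1) by auto
  have dc: "arc G c = a" "arc G d = b" using P(9) ptsZ by (auto simp: c_def d_def)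
  have arcZ: "arc G y \<notin> Z" if "y \<in> ?X" "y \<notin> Z" for y
  proof
    assume "arc G y \<in> Z"
    then have "arc G (arc G y) \<in> Z" using dc by (auto simp: Z_def c_def d_def)
    then show False using P(9) that by simp
  qed
  have minv: "fpf_involution_on ?X ?m" by (rule marked_inv[OF G])
  have ainv: "fpf_involution_on (?X - Z) (arc G)"
    using P arcZ by (simp add: fpf_involution_on_def)
  have symR: "sym R" unfolding R_def by (intro sym_Un sym_links minv ainv)
  have mY: "?m y \<in> ?Y \<longleftrightarrow> y \<in> ?Y" if "y \<in> ?X" for y
    using marked_pts[OF G that] that by (simp add: epts_def)
  have RY: "R\<^sup>* `` {y} \<subseteq> ?Y" if "y \<in> ?Y" for y
  proof (rule class_subset[OF that], rule subsetI)
    fix z assume "z \<in> R `` ?Y"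
    then obtain x where x: "x \<in> ?Y" "(x, z) \<in> R" by blast
    then consider "z = ?m x" | "z = arc G x" "x \<notin> Z" by (auto simp: R_def links_iff)
    then show "z \<in> ?Y" by cases (use mY E(1) x T(7) in \<open>auto simp: Z_def\<close>)
  qed
  have RY': "R\<^sup>* `` {y} \<subseteq> ?Y'" if "y \<in> ?Y'" for y
  proof (rule class_subset[OF that], rule subsetI)
    fix z assume "z \<in> R `` ?Y'"
    then obtain x where x: "x \<in> ?Y'" "(x, z) \<in> R" by blast
    then consider "z = ?m x" | "z = arc G x" "x \<notin> Z" by (auto simp: R_def links_iff)
    then show "z \<in> ?Y'" by cases (use E(4) x T'(7) in \<open>auto simp: Z_def\<close>)
  qed
  have ends: "\<exists>z'. z' \<noteq> z \<and> R\<^sup>* `` {z} \<inter> Z = {z, z'}" if "z \<in> Z" for z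
    unfolding R_def by (rule path_ends[OF D(3) minv ainv _ that]) (use ptsZ in \<open>simp add: Z_def\<close>)
  have ne: "a \<noteq> c" "a \<noteq> d" "b \<noteq> c" "b \<noteq> d" using T T' Y' by auto
  have ab: "(a, b) \<in> R\<^sup>*"
  proof -
    obtain z' where z': "z' \<noteq> a" "R\<^sup>* `` {a} \<inter> Z = {a, z'}" using ends[of a] by (auto simp: Z_def)
    then have "z' \<in> R\<^sup>* `` {a}" "z' \<in> Z" by auto
    then have "z' \<in> ?Y" using RY[OF T(3)] by blast
    then have "z' = b" using \<open>z' \<in> Z\<close> z'(1) T'(3,4) Y' by (auto simp: Z_def)
    then show ?thesis using \<open>z' \<in> R\<^sup>* `` {a}\<close> by simp
  qed
  have cd: "(c, d) \<in> R\<^sup>*"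
  proof -
    obtain z' where z': "z' \<noteq> c" "R\<^sup>* `` {c} \<inter> Z = {c, z'}" using ends[of c] by (auto simp: Z_def)
    then have "z' \<in> R\<^sup>* `` {c}" "z' \<in> Z" by auto
    then have "z' \<in> ?Y'" using RY'[OF T'(3)] by blast
    then have "z' = d" using \<open>z' \<in> Z\<close> z'(1) T(3,4) Y' by (auto simp: Z_def)
    then show ?thesis using \<open>z' \<in> R\<^sup>* `` {c}\<close> by simp
  qed
  have ac: "(a, c) \<notin> R\<^sup>*" using RY[OF T(3)] T'(3) Y' by auto
  have 1: "num_classes ?X (R \<union> {(a, c), (c, a)} \<union> {(b, d), (d, b)}) + 1
      = num_classes ?X (R \<union> {(a, b), (b, a)} \<union> {(c, d), (d, c)})"
    by (rule num_classes_switch_eq[OF D(3) symR ptsZ(1,2,3,4) ab cd ac])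
  have e1: "face_rel G B = R \<union> {(a, c), (c, a)} \<union> {(b, d), (d, b)}"
    using ptsZ dc by (auto simp: face_rel_def R_def links_iff Z_def c_def d_def)
  have hc: "arc ?H y = (if y = a then b else if y = b then a else arc G y)" if "y \<in> ?Y" for y
    by (rule subgraph_arc_cases[OF G cut that])
  have hc': "arc ?H' y = (if y = c then d else if y = d then c else arc G y)" if "y \<in> ?Y'" for y
    by (rule subgraph_arc_cases[OF G cut'' that])
  have YX: "?X = ?Y' \<union> ?Y" using Y' E(1) by auto
  have l1: "links ?Y (arc ?H) = links (?Y - {a, b}) (arc G) \<union> {(a, b), (b, a)}"
    using hc T(3,4) by (auto simp: links_iff split: if_splits)
  have l2: "links ?Y' (arc ?H') = links (?Y' - {c, d}) (arc G) \<union> {(c, d), (d, c)}"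
    using hc' T'(3,4) by (auto simp: links_iff split: if_splits)
  have l3: "links (?X - Z) (arc G) = links (?Y' - {c, d}) (arc G) \<union> links (?Y - {a, b}) (arc G)"
    using T(3,4) T'(3,4) Y' E(1) by (auto simp: links_iff Z_def)
  have l4: "links ?X ?m = links ?Y' ?m \<union> links ?Y ?m"
    unfolding YX by (auto simp: links_iff)
  have e2: "R \<union> {(a, b), (b, a)} \<union> {(c, d), (d, c)} = face_rel ?H' B \<union> face_rel ?H B"
    unfolding R_def face_rel_def subgraph_on_sel l1 l2 l3 l4 by blast
  have "num_classes (?Y' \<union> ?Y) (face_rel ?H' B \<union> face_rel ?H B)
      = num_classes ?Y' (face_rel ?H' B) + num_classes ?Y (face_rel ?H B)"
  proof (rule num_classes_Un)
    show "finite ?Y" "finite ?Y'" using D(3) by (auto simp: epts_def)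
    show "?Y' \<inter> ?Y = {}" using Y' by auto
    have "fpf_involution_on ?Y (marked G B)" "fpf_involution_on ?Y' (marked G B)"
      using minv E by (auto simp: fpf_involution_on_def)
    note inv = this subgraph_arc_inv[OF G cut] subgraph_arc_inv[OF G cut'']
    show "face_rel ?H' B \<subseteq> ?Y' \<times> ?Y'" "face_rel ?H B \<subseteq> ?Y \<times> ?Y"
      unfolding face_rel_def subgraph_on_sel by (intro Un_least links_subset inv order_refl)+
  qed
  then show ?thesis using 1 unfolding e1 e2 YX[symmetric] by simp
qed

subsection \<open>Joins\<close>

text \<open>Around a vertex carrying neither \<open>a\<close> nor \<open>b\<close>, a walk starting
  in \<open>Q\<close> never leaves \<open>Q\<close>.\<close>

lemma two_cut_orbit:
  assumes G: "ribbon_graph G" and cut: "two_cut G Q a b"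
    and "y \<in> epts G Q" "x \<in> pts G - epts G Q" "vert_of G x = vert_of G y"
  shows "vert_of G y = vert_of G a \<or> vert_of G y = vert_of G b"
proof (rule ccontr)
  assume no: "\<not> ?thesis"
  let ?C = "{z \<in> epts G Q. vert_of G z = vert_of G y}"
  note P = ribbon_pts[OF G] and E = epts_closed[OF G] and T = two_cutD[OF cut]
  have "orbit2 (seg G) (arc G) y \<subseteq> ?C"
  proof (rule orbit2_subset)
    fix q assume "q \<in> ?C"
    then have q: "q \<in> epts G Q" "q \<in> pts G" "vert_of G q = vert_of G y" using E by auto
    show "seg G q \<in> ?C" using q E(2) P(12) by simp
    have "q \<noteq> a" "q \<noteq> b" using no q(3) by auto
    then show "arc G q \<in> ?C" using q T(7) P(13) by simp
  qed (use assms in simp)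
  moreover have "x \<in> orbit2 (seg G) (arc G) y"
    using ribbon_graphD(11)[OF G E(1)[OF assms(3)]] assms(4,5) by simp
  ultimately show False using assms(4) by auto
qed

text \<open>The arc in the definition of a join can be left only at its two ends, so at most two
  arcs lead from \<open>P\<close> to \<open>Q\<close>. Their number is even, and positive because
  \<open>G\<close> is connected.\<close>

lemma is_join_two_cut:
  assumes G: "ribbon_graph G" and join: "is_join G P Q"
  shows "\<exists>a b. two_cut G (edges Q) a b \<and> edges P = edges G - edges Q"
proof -
  note R = ribbon_pts[OF G] and E = epts_closed[OF G] and D = ribbon_graphD[OF G]
  have con: "rg_connected G" and sP: "ribbon_subgraph P G" and sQ: "ribbon_subgraph Q G"
    and ne: "edges P \<noteq> {}" "edges Q \<noteq> {}" and EG: "edges G = edges P \<union> edges Q"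
    using join by (auto simp: is_join_def)
  obtain v p n where v: "verts P \<inter> verts Q = {v}" and disj: "edges P \<inter> edges Q = {}"
    and p: "p \<in> pts G" "vert_of G p = v"
    and arcs: "\<And>q. q \<in> pts G \<Longrightarrow> vert_of G q = v \<Longrightarrow>
      (edge_of G q \<in> edges P \<longrightarrow> q \<in> arc_pts G p n) \<and> (edge_of G q \<in> edges Q \<longrightarrow> q \<notin> arc_pts G p n)"
    using join unfolding is_join_def by blast
  let ?Y = "epts G (edges P)" and ?s = "\<lambda>i. (next_seg G ^^ i) p"
  let ?C = "{y \<in> ?Y. arc G y \<notin> ?Y}"
  have EP: "edges P = edges G - edges Q" using EG disj by auto
  have sub: "y \<in> ?Y" if "y \<in> arc_pts G p n" for y
  proof -
    obtain i where "y = ?s i \<or> y = seg G (?s i)" using \<open>y \<in> _\<close> by (auto simp: arc_pts_def)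
    then have y: "y \<in> pts G" "vert_of G y = v" using next_seg_pts[OF G p(1), of i] R p(2) by auto
    then show ?thesis using arcs[OF y] that D(5) EG by (auto simp: epts_def)
  qed
  \<comment> \<open>An arc from \<open>P\<close> to \<open>Q\<close> lies at the common vertex, so
    its end in \<open>P\<close> is on the given arc; a point in the interior has its neighbour there
    too, hence in \<open>P\<close>.\<close>
  have Cn: "?C \<subseteq> {p, seg G (?s (n - 1))}"
  proof
    fix y assume "y \<in> ?C"
    then have y: "y \<in> ?Y" "arc G y \<notin> ?Y" "y \<in> pts G" by (auto simp: epts_def)
    have "edge_of G (arc G y) \<in> edges Q" using y R(3) D(5) EG by (auto simp: epts_def)
    then have "vert_of G (arc G y) \<in> verts Q" using sQ R(3) y by (auto simp: ribbon_subgraph_def)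
    moreover have "vert_of G y \<in> verts P" using sP y by (auto simp: ribbon_subgraph_def epts_def)
    ultimately have "vert_of G y = v" using v R(13) y by auto
    then have "y \<in> arc_pts G p n" using arcs[OF y(3)] y(1) by (simp add: epts_def)
    then obtain i where i: "i < n" "y = ?s i \<or> y = seg G (?s i)" by (auto simp: arc_pts_def)
    have S: "?s j \<in> arc_pts G p n" "seg G (?s j) \<in> arc_pts G p n" if "j < n" for j
      using that by (auto simp: arc_pts_def)
    show "y \<in> {p, seg G (?s (n - 1))}" using i(2)
    proof
      assume yi: "y = ?s i"
      show ?thesis
      proof (cases i)
        case (Suc j)
        have "seg G (?s j) \<in> pts G" using next_seg_pts[OF G p(1)] R by simp
        then have "arc G y = seg G (?s j)" using yi Suc R(9) by (simp add: next_seg_def)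
        then show ?thesis using y(2) sub S(2)[of j] i Suc by simp
      qed (use yi in simp)
    next
      assume yi: "y = seg G (?s i)"
      then have "arc G y = ?s (Suc i)" by (simp add: next_seg_def)
      then have "\<not> Suc i < n" using y(2) sub S(1)[of "Suc i"] by auto
      then have "i = n - 1" using i by simp
      then show ?thesis using yi by simp
    qed
  qed
  have finY: "finite ?Y" using D(3) by (simp add: epts_def)
  have "card ?C \<le> card {p, seg G (?s (n - 1))}" by (rule card_mono[OF _ Cn]) simp
  also have "\<dots> \<le> 2" by (simp add: card_insert_if)
  finally have le: "card ?C \<le> 2" .
  \<comment> \<open>\<open>seg G\<close> pairs up all points of \<open>P\<close>, and
    \<open>arc G\<close> those whose arc stays in \<open>P\<close>.\<close>
  have "fpf_involution_on ?Y (seg G)" using E R by (simp add: fpf_involution_on_def)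
  then have "even (card ?Y)" using even_card_involution finY by blast
  moreover have "fpf_involution_on (?Y - ?C) (arc G)" using E(1) R by (auto simp: fpf_involution_on_def)
  then have "even (card (?Y - ?C))" using even_card_involution finY by blast
  moreover have "card ?Y = card ?C + card (?Y - ?C)"
    using card_Int_Diff[OF finY, of ?C] by (simp add: Int_absorb1)
  ultimately have "even (card ?C)" by simp
  moreover have "?C \<noteq> {}"
  proof
    assume C: "?C = {}"
    obtain e e' where e: "e \<in> edges P" "e' \<in> edges Q" using ne by auto
    then have "e \<in> edge_of G ` pts G" "e' \<in> edge_of G ` pts G"
      unfolding edges_eq[OF G, symmetric] EG by auto
    then obtain y z where yz: "y \<in> pts G" "edge_of G y \<in> edges P" "z \<in> pts G" "edge_of G z \<in> edges Q"
      using e by auto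
    have "(point_rel G)\<^sup>* `` {y} \<subseteq> ?Y"
    proof (rule class_subset, use yz in \<open>simp add: epts_def\<close>, rule subsetI)
      fix z assume "z \<in> point_rel G `` ?Y"
      then obtain x where "x \<in> ?Y" "z = arc G x \<or> z = seg G x \<or> z = side G x"
        by (auto simp: point_rel_def links_iff)
      then show "z \<in> ?Y" using E C by blast
    qed
    moreover have "(y, z) \<in> (point_rel G)\<^sup>*" using con connected_iff[OF G] yz by blast
    ultimately have "z \<in> ?Y" by blast
    then show False using yz disj by (auto simp: epts_def)
  qed
  then have "card ?C \<noteq> 0" using finY by simp
  ultimately have "card ?C = 2" using le by presburger
  then obtain a b where "?C = {a, b}" "a \<noteq> b" by (auto simp: card_2_iff)
  then have "two_cut G (edges P) a b" using EG by (simp add: two_cut_def)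
  then have "two_cut G (edges G - edges P) (arc G a) (arc G b)" by (rule two_cut_compl[OF G])
  moreover have "edges G - edges P = edges Q" using EG disj by auto
  ultimately show ?thesis using EP by auto
qed

text \<open>The arc required at the common vertex is the walk of \<open>arc_exit\<close> through the
  complement of \<open>Q\<close>, from \<open>arc G a\<close> to \<open>arc G b\<close>.\<close>

lemma is_joinI:
  assumes G: "ribbon_graph G" and con: "rg_connected G" and cut: "two_cut G Q a b"
  shows "is_join G (subgraph_on G (vert_of G ` epts G (edges G - Q)) (edges G - Q))
    (subgraph_on G (vert_of G ` epts G Q) Q)"
proof -
  let ?Q' = "edges G - Q"
  let ?Y = "epts G ?Q'"
  let ?P = "subgraph_on G (vert_of G ` ?Y) ?Q'" and ?Q = "subgraph_on G (vert_of G ` epts G Q) Q"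
  note R = ribbon_pts[OF G] and E = epts_closed[OF G] and D = ribbon_graphD[OF G]
  define c d where "c = arc G a" and "d = arc G b"
  have cut': "two_cut G ?Q' c d" unfolding c_def d_def by (rule two_cut_compl[OF G cut])
  note T = two_cutD[OF cut] and T' = two_cutD[OF cut']
  have pts: "a \<in> pts G" "b \<in> pts G" "c \<in> pts G" "d \<in> pts G" using T T' E(1) by auto
  have QQ: "edges G - ?Q' = Q" using T(1) by auto
  have Y: "?Y = pts G - epts G Q" by (rule epts_Diff[OF G])
  have eQ: "y \<in> epts G Q \<longleftrightarrow> y \<in> pts G \<and> y \<notin> ?Y" for y using Y E(1) by blast
  obtain n where n: "n > 0" "\<And>i. i < n \<Longrightarrow> (next_seg G ^^ i) c \<in> ?Y"
    "seg G ((next_seg G ^^ (n - 1)) c) = d" "(next_seg G ^^ n) c = arc G d"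
    by (rule arc_exit[OF G, where Y = ?Y and a = c and b = d])
      (use cut' E in \<open>auto simp: two_cut_def\<close>)
  have vd: "vert_of G d = vert_of G c"
    unfolding n(3)[symmetric] using next_seg_pts[OF G pts(3)] R(12) by simp
  have vab: "vert_of G a = vert_of G c" "vert_of G b = vert_of G c"
    using vd R(13) pts by (auto simp: c_def d_def)
  let ?S = "arc_pts G c n"
  have SY: "?S \<subseteq> ?Y" using n(2) E(2) by (auto simp: arc_pts_def)
  have cS: "c \<in> ?S" unfolding arc_pts_def using n(1) by force
  have dS: "d \<in> ?S" unfolding arc_pts_def n(3)[symmetric] using n(1) by (intro UN_I[of "n - 1"]) auto
  have Sseg: "seg G y \<in> ?S" if "y \<in> ?S" for y
  proof -
    obtain i where i: "i < n" "y = (next_seg G ^^ i) c \<or> y = seg G ((next_seg G ^^ i) c)"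
      using \<open>y \<in> ?S\<close> by (auto simp: arc_pts_def)
    then show ?thesis using R(7)[OF next_seg_pts(1)[OF G pts(3), of i]] by (auto simp: arc_pts_def)
  qed
  have Sarc: "arc G y \<in> ?S \<union> (pts G - ?Y)" if "y \<in> ?S" for y
  proof -
    obtain i where i: "i < n" "y = (next_seg G ^^ i) c \<or> y = seg G ((next_seg G ^^ i) c)"
      using \<open>y \<in> ?S\<close> by (auto simp: arc_pts_def)
    from i(2) show ?thesis
    proof
      assume y: "y = (next_seg G ^^ i) c"
      show ?thesis
      proof (cases i)
        case 0 then show ?thesis using y T'(5) R(3) pts by simp
      next
        case (Suc j)
        have "seg G ((next_seg G ^^ j) c) \<in> pts G" using next_seg_pts(1)[OF G pts(3)] R(1) by simp
        then have "arc G y = seg G ((next_seg G ^^ j) c)" using y Suc R(9) by (simp add: next_seg_def)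
        then show ?thesis using i(1) Suc by (auto simp: arc_pts_def)
      qed
    next
      assume y: "y = seg G ((next_seg G ^^ i) c)"
      then have e: "arc G y = (next_seg G ^^ Suc i) c" by (simp add: next_seg_def)
      show ?thesis
      proof (cases "Suc i < n")
        case True
        then show ?thesis unfolding e arc_pts_def by blast
      next
        case False
        then have "Suc i = n" using i(1) by simp
        then show ?thesis unfolding e using n(4) T'(6) R(3) pts by simp
      qed
    qed
  qed
  \<comment> \<open>The walk together with all points of \<open>Q\<close> is closed under both
    involutions, so the vertex has no further segments of the complement.\<close>
  have "orbit2 (seg G) (arc G) c \<subseteq> ?S \<union> (pts G - ?Y)"
  proof (rule orbit2_subset)
    fix q assume q: "q \<in> ?S \<union> (pts G - ?Y)"
    show "seg G q \<in> ?S \<union> (pts G - ?Y)" using q Sseg E(2) eQ by blast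
    show "arc G q \<in> ?S \<union> (pts G - ?Y)"
    proof (cases "q \<in> ?S")
      case False
      then have "q \<in> epts G Q" using q eQ by blast
      then show ?thesis
        using T(7)[of q] cS dS eQ[of "arc G q"] by (cases "q = a \<or> q = b") (auto simp: c_def d_def)
    qed (rule Sarc)
  qed (use cS in simp)
  then have all: "q \<in> ?S \<union> (pts G - ?Y)" if "q \<in> pts G" "vert_of G q = vert_of G c" for q
    using D(11)[OF pts(3)] that by blast
  have iso: "verts G = vert_of G ` pts G"
    using con connected_iff[OF G] pts D(4) by (auto simp: isolated_def)
  have "v = vert_of G c" if v: "v \<in> vert_of G ` ?Y" "v \<in> vert_of G ` epts G Q" for v
  proof -
    obtain x y where xy: "x \<in> ?Y" "v = vert_of G x" "y \<in> epts G Q" "v = vert_of G y" using v by blast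
    then have "vert_of G y = vert_of G a \<or> vert_of G y = vert_of G b"
      using two_cut_orbit[OF G cut xy(3), of x] Y by auto
    then show ?thesis using vab xy by auto
  qed
  moreover have "vert_of G c \<in> vert_of G ` ?Y" using T' by auto
  moreover have "vert_of G c \<in> vert_of G ` epts G Q" using T vab by (metis imageI)
  ultimately have v: "vert_of G ` ?Y \<inter> vert_of G ` epts G Q = {vert_of G c}" by blast
  have sub: "ribbon_subgraph (subgraph_on G (vert_of G ` epts G B) B) G" if "B \<subseteq> edges G" for B
    unfolding ribbon_subgraph_def subgraph_on_sel using that D(4) by (auto simp: epts_def)
  have conP: "rg_connected ?P" by (rule connected_subgraph_cut[OF G con cut'])
  have conQ: "rg_connected ?Q" by (rule connected_subgraph_cut[OF G con cut])
  have neP: "?Q' \<noteq> {}" "Q \<noteq> {}" using T T' by (auto simp: epts_def)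
  have VV: "verts G = vert_of G ` ?Y \<union> vert_of G ` epts G Q" unfolding iso Y using E(1) by auto
  have S: "(edge_of G q \<in> ?Q' \<longrightarrow> q \<in> ?S) \<and> (edge_of G q \<in> Q \<longrightarrow> q \<notin> ?S)"
    if "q \<in> pts G" "vert_of G q = vert_of G c" for q
    using all[OF that] SY that(1) by (auto simp: epts_def)
  show ?thesis unfolding is_join_def subgraph_on_sel
  proof (intro conjI exI[of _ "vert_of G c"] bexI[OF _ pts(3)] exI[of _ n] con conP conQ neP VV v refl)
    show "ribbon_subgraph ?P G" "ribbon_subgraph ?Q G" using sub T(1) by auto
    show "edges G = edges G - Q \<union> Q" using T(1) by auto
    show "(edges G - Q) \<inter> Q = {}" by auto
  qed (use S in blast)
qed

text \<open>By \<open>num_faces_cut\<close> the number of boundary components of \<open>G\<close> is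
  one less than the sum over the parts, both for \<open>A\<close> and for its complement. This makes
  up for the constant 2 occurring twice in the sum of the genera.\<close>

lemma is_join_facts:
  assumes G: "ribbon_graph G" and join: "is_join G P Q"
  shows "ribbon_graph P" "ribbon_graph Q" "rg_connected P" "rg_connected Q" "edges Q \<noteq> {}"
    "edges P \<inter> edges Q = {}" "edges G = edges P \<union> edges Q"
    "dual_genus G A = dual_genus P A + dual_genus Q A"
proof -
  note D = ribbon_graphD[OF G]
  obtain a b where cut: "two_cut G (edges Q) a b" and EP: "edges P = edges G - edges Q"
    using is_join_two_cut[OF G join] by blast
  note cut' = two_cut_compl[OF G cut, folded EP]
  note T = two_cutD[OF cut] and T' = two_cutD[OF cut']
  have con: "rg_connected G" and sP: "ribbon_subgraph P G" and sQ: "ribbon_subgraph Q G"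
    using join by (auto simp: is_join_def)
  have P: "P = subgraph_on G (verts P) (edges P)" and Q: "Q = subgraph_on G (verts Q) (edges Q)"
    using sP sQ by (auto simp: ribbon_subgraph_def)
  have VP: "finite (verts P)" "vert_of G ` epts G (edges P) \<subseteq> verts P"
    and VQ: "finite (verts Q)" "vert_of G ` epts G (edges Q) \<subseteq> verts Q"
    using sP sQ D(1) finite_subset by (auto simp: ribbon_subgraph_def epts_def)
  show rP: "ribbon_graph P" using ribbon_subgraph_cut[OF G cut' VP] P[symmetric] by simp
  show rQ: "ribbon_graph Q" using ribbon_subgraph_cut[OF G cut VQ] Q[symmetric] by simp
  show cP: "rg_connected P" and cQ: "rg_connected Q" and "edges Q \<noteq> {}"
    using join by (auto simp: is_join_def)
  show disj: "edges P \<inter> edges Q = {}" and EG: "edges G = edges P \<union> edges Q" using EP T(1) by auto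
  have pP: "pts P = epts G (edges P)" and pQ: "pts Q = epts G (edges Q)"
    by (rule trans[OF arg_cong[OF P, of pts] subgraph_on_sel(3)]
        trans[OF arg_cong[OF Q, of pts] subgraph_on_sel(3)])+
  have ne: "pts G \<noteq> {}" "pts P \<noteq> {}" "pts Q \<noteq> {}" using pP pQ T T' epts_closed(1)[OF G] by blast+
  have iso: "isolated G = {}" "isolated P = {}" "isolated Q = {}"
    using connected_iff[OF G ne(1)] connected_iff[OF rP ne(2)] connected_iff[OF rQ ne(3)] con cP cQ by auto
  have f: "card (boundary_components G B) + 1
      = card (boundary_components P B) + card (boundary_components Q B)" for B
    using num_faces_cut[OF G cut, of B "verts P" "verts Q"] P[symmetric] Q[symmetric] pP pQ iso
    by (simp add: card_boundary_components_ribbon[OF G] card_boundary_components_ribbon[OF rP]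
        card_boundary_components_ribbon[OF rQ] EP[symmetric])
  have "card (edges G) = card (edges P) + card (edges Q)"
    unfolding EG by (rule card_Un_disjoint) (use D(2) EG disj in auto)
  then show "dual_genus G A = dual_genus P A + dual_genus Q A"
    using f[of A] f[of "- A"] by (simp add: dual_genus_def)
qed

section \<open>Iterated joins\<close>

lemma iterated_join_facts:
  assumes "is_iterated_join G Hs" "ribbon_graph G" "rg_connected G"
  shows "(\<forall>i<length Hs. ribbon_graph (Hs ! i) \<and> rg_connected (Hs ! i)) \<and>
    edges G = (\<Union>i<length Hs. edges (Hs ! i)) \<and>
    (\<forall>i<length Hs. \<forall>j<length Hs. i \<noteq> j \<longrightarrow> edges (Hs ! i) \<inter> edges (Hs ! j) = {}) \<and>
    dual_genus G A = (\<Sum>i<length Hs. dual_genus (Hs ! i) A)"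
  using assms
proof (induction rule: is_iterated_join.induct)
  case (single G)
  then show ?case by (simp add: lessThan_Suc)
next
  case (snoc P Hs G Q)
  note J = is_join_facts[OF snoc.prems(1) snoc.hyps(2)]
  have IH: "\<forall>i<length Hs. ribbon_graph (Hs ! i) \<and> rg_connected (Hs ! i)"
    "edges P = (\<Union>i<length Hs. edges (Hs ! i))"
    "\<forall>i<length Hs. \<forall>j<length Hs. i \<noteq> j \<longrightarrow> edges (Hs ! i) \<inter> edges (Hs ! j) = {}"
    "dual_genus P A = (\<Sum>i<length Hs. dual_genus (Hs ! i) A)"
    using snoc.IH J(1,3) by blast+
  have nth: "(Hs @ [Q]) ! i = (if i < length Hs then Hs ! i else Q)" if "i < Suc (length Hs)" for i
    using that by (auto simp: nth_append less_Suc_eq)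
  have sub: "edges (Hs ! i) \<inter> edges Q = {}" if "i < length Hs" for i
    using IH(2) J(6) that by blast
  have "edges G = (\<Union>i<Suc (length Hs). edges ((Hs @ [Q]) ! i))"
    using J(7) IH(2) by (auto simp: lessThan_Suc nth_append)
  moreover have "dual_genus G A = (\<Sum>i<Suc (length Hs). dual_genus ((Hs @ [Q]) ! i) A)"
    using J(8)[of A] IH(4) by (simp add: nth_append)
  moreover have "edges ((Hs @ [Q]) ! i) \<inter> edges ((Hs @ [Q]) ! j) = {}"
    if "i < Suc (length Hs)" "j < Suc (length Hs)" "i \<noteq> j" for i j
    using that IH(3) sub by (auto simp: nth less_Suc_eq)
  moreover have "ribbon_graph ((Hs @ [Q]) ! i) \<and> rg_connected ((Hs @ [Q]) ! i)"
    if "i < Suc (length Hs)" for i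
    using that IH(1) J(2,4) by (auto simp: nth)
  ultimately show ?case by simp
qed

lemma exists_monochromatic_cut:
  assumes G: "ribbon_graph G" and con: "rg_connected G"
    and le: "dual_genus G {} \<le> 1" "dual_genus G A \<le> 1"
    and A: "\<not> edges G \<subseteq> A" "edges G \<inter> A \<noteq> {}"
  shows "\<exists>Q a b. two_cut G Q a b \<and> (Q \<subseteq> A \<or> Q \<inter> A = {})"
proof -
  interpret point_map "pts G" "seg G" "side G" "arc G" "edge_of G" by (rule point_map_ribbon[OF G])
  obtain p0 q0 where pq: "p0 \<in> pts G" "q0 \<in> pts G" "edge_of G p0 \<in> A" "edge_of G q0 \<notin> A"
    using A unfolding edges_eq[OF G] by blast
  then have c: "isolated G = {}" "\<And>p q. p \<in> pts G \<Longrightarrow> q \<in> pts G \<Longrightarrow> (p, q) \<in> (point_rel G)\<^sup>*"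
    using con connected_iff[OF G] by auto
  have "\<exists>W\<subseteq>pts G. W \<noteq> {} \<and> (\<forall>w\<in>W. seg G w \<in> W \<and> side G w \<in> W) \<and>
    ((\<forall>w\<in>W. edge_of G w \<in> A) \<or> (\<forall>w\<in>W. edge_of G w \<notin> A)) \<and> card {w \<in> W. arc G w \<notin> W} = 2"
    using le by (intro exists_run_low_genus[OF c(2)[unfolded point_rel_def] _ _ pq])
      (simp_all add: dual_genus_def card_boundary_components_ribbon[OF G] F_face_rel[OF G] c(1) edges_eq[OF G])
  then obtain W where W: "W \<subseteq> pts G" "W \<noteq> {}" "\<And>w. w \<in> W \<Longrightarrow> seg G w \<in> W" "\<And>w. w \<in> W \<Longrightarrow> side G w \<in> W"
    "(\<forall>w\<in>W. edge_of G w \<in> A) \<or> (\<forall>w\<in>W. edge_of G w \<notin> A)" "card {w \<in> W. arc G w \<notin> W} = 2"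
    by blast
  let ?Q = "edge_of G ` W"
  \<comment> \<open>\<open>W\<close> is closed under \<open>seg G\<close> and \<open>side G\<close>,
    so it contains all four points of each of its edges.\<close>
  have "epts G ?Q = W"
  proof (intro equalityI subsetI)
    fix q assume "q \<in> epts G ?Q"
    then obtain w where w: "w \<in> W" "edge_of G q = edge_of G w" "q \<in> pts G" by (auto simp: epts_def)
    then have "q \<in> {w, seg G w, side G w, seg G (side G w)}" using ed_eq[of w q] W(1) by auto
    then show "q \<in> W" using W(3,4) w(1) by auto
  qed (use W(1) in \<open>auto simp: epts_def\<close>)
  moreover obtain a b where "a \<noteq> b" "{w \<in> W. arc G w \<notin> W} = {a, b}" using W(6) by (auto simp: card_2_iff)
  moreover have "?Q \<subseteq> edges G" using W(1) edges_eq[OF G] by blast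
  ultimately have "two_cut G ?Q a b" by (simp add: two_cut_def)
  moreover have "?Q \<subseteq> A \<or> ?Q \<inter> A = {}" using W(5) by blast
  ultimately show ?thesis by blast
qed

text \<open>Induction on the number of edges, with the part \<open>H\<close> split off as the last
  of the join. \<open>H\<close> is monochromatic, so it contributes the same nonnegative amount to
  the Euler genera of \<open>G\<close> and of its dual; by additivity the rest satisfies the
  hypotheses again.\<close>

lemma exists_iterated_join:
  assumes "ribbon_graph G" "rg_connected G" "dual_genus G {} \<le> 1" "dual_genus G A = dual_genus G {}"
  shows "\<exists>Hs. is_iterated_join G Hs \<and> (\<forall>i<length Hs. edges (Hs ! i) \<subseteq> A \<or> edges (Hs ! i) \<inter> A = {})"
  using assms
proof (induction "card (edges G)" arbitrary: G rule: less_induct)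
  case less
  note G = less.prems(1) and con = less.prems(2)
  show ?case
  proof (cases "edges G \<subseteq> A \<or> edges G \<inter> A = {}")
    case True
    then show ?thesis by (intro exI[of _ "[G]"]) (simp add: is_iterated_join.single)
  next
    case False
    then obtain Q a b where cut: "two_cut G Q a b" and QA: "Q \<subseteq> A \<or> Q \<inter> A = {}"
      using exists_monochromatic_cut[OF G con, of A] less.prems by auto
    define H where "H = subgraph_on G (vert_of G ` epts G Q) Q"
    define P where "P = subgraph_on G (vert_of G ` epts G (edges G - Q)) (edges G - Q)"
    have join: "is_join G P H" unfolding H_def P_def by (rule is_joinI[OF G con cut])
    note J = is_join_facts[OF G join]
    have EH: "edges H = Q" by (simp add: H_def subgraph_on_sel)
    have "dual_genus H A = dual_genus H {}" by (rule dual_genus_cong[OF J(2)]) (use QA EH in auto)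
    moreover have "dual_genus H {} \<ge> 0" by (rule dual_genus_nonneg[OF J(2,4)])
    ultimately have "dual_genus P {} \<le> 1" "dual_genus P A = dual_genus P {}"
      using J(8)[of A] J(8)[of "{}"] less.prems by simp_all
    moreover have "edges P \<subset> edges G" using J(5-7) by blast
    then have "card (edges P) < card (edges G)" using ribbon_graphD(2)[OF G] by (rule psubset_card_mono[rotated])
    ultimately obtain Hs where Hs: "is_iterated_join P Hs"
      "\<forall>i<length Hs. edges (Hs ! i) \<subseteq> A \<or> edges (Hs ! i) \<inter> A = {}"
      using less.hyps J(1,3) by blast
    have "is_iterated_join G (Hs @ [H])" by (rule is_iterated_join.snoc[OF Hs(1) join])
    moreover have "\<forall>i<length (Hs @ [H]). edges ((Hs @ [H]) ! i) \<subseteq> A \<or> edges ((Hs @ [H]) ! i) \<inter> A = {}"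
      using Hs(2) QA EH by (auto simp: nth_append less_Suc_eq)
    ultimately show ?thesis by blast
  qed
qed

section \<open>Join-biseparations and Euler genus\<close>

lemma join_biseparation_dual_genus:
  assumes G: "ribbon_graph G" and con: "rg_connected G" and J: "join_biseparation G A Hs"
  shows "dual_genus G A = (\<Sum>i<length Hs. dual_genus (Hs ! i) {})"
    "dual_genus G {} = (\<Sum>i<length Hs. dual_genus (Hs ! i) {})"
    "\<forall>i<length Hs. ribbon_graph (Hs ! i) \<and> rg_connected (Hs ! i)"
proof -
  obtain I where I: "is_iterated_join G Hs" "I \<subseteq> {..<length Hs}" "A = (\<Union>i\<in>I. edges (Hs ! i))"
    using J by (auto simp: join_biseparation_def)
  note facts = iterated_join_facts[OF I(1) G con]
  show r: "\<forall>i<length Hs. ribbon_graph (Hs ! i) \<and> rg_connected (Hs ! i)" using facts by blast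
  show "dual_genus G {} = (\<Sum>i<length Hs. dual_genus (Hs ! i) {})" using facts by blast
  \<comment> \<open>The parts are edge-disjoint, so each lies entirely inside or entirely outside
    \<open>A\<close>.\<close>
  have "dual_genus (Hs ! i) A = dual_genus (Hs ! i) {}" if "i < length Hs" for i
  proof (rule dual_genus_cong)
    show "ribbon_graph (Hs ! i)" using r that by blast
    have disj: "edges (Hs ! i) \<inter> edges (Hs ! j) = {}" if "j \<in> I" "i \<noteq> j" for j
      using facts I(2) that \<open>i < length Hs\<close> by blast
    show "edges (Hs ! i) \<subseteq> A \<or> edges (Hs ! i) \<inter> A = {}"
    proof (cases "i \<in> I")
      case True then show ?thesis using I(3) by blast
    next
      case False
      then have "edges (Hs ! i) \<inter> edges (Hs ! j) = {}" if "j \<in> I" for j using disj that by blast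
      then show ?thesis unfolding I(3) by blast
    qed
  qed
  then have "(\<Sum>i<length Hs. dual_genus (Hs ! i) A) = (\<Sum>i<length Hs. dual_genus (Hs ! i) {})"
    by (intro sum.cong) auto
  then show "dual_genus G A = (\<Sum>i<length Hs. dual_genus (Hs ! i) {})" using facts[of A] by simp
qed

lemma exists_join_biseparation:
  assumes G: "ribbon_graph G" and con: "rg_connected G" and "A \<subseteq> edges G"
    and "dual_genus G {} \<le> 1" "dual_genus G A = dual_genus G {}"
  shows "\<exists>Hs. join_biseparation G A Hs"
proof -
  obtain Hs where Hs: "is_iterated_join G Hs"
    and mono: "\<And>i. i < length Hs \<Longrightarrow> edges (Hs ! i) \<subseteq> A \<or> edges (Hs ! i) \<inter> A = {}"
    using exists_iterated_join assms by blast
  define I where "I = {i. i < length Hs \<and> edges (Hs ! i) \<subseteq> A}"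
  have un: "edges G = (\<Union>i<length Hs. edges (Hs ! i))" using iterated_join_facts[OF Hs G con] by blast
  have "A = (\<Union>i\<in>I. edges (Hs ! i))"
  proof (intro equalityI subsetI)
    fix e assume e: "e \<in> A"
    then obtain i where i: "i < length Hs" "e \<in> edges (Hs ! i)" using un assms(3) by blast
    then have "i \<in> I" using mono[OF i(1)] e unfolding I_def by blast
    then show "e \<in> (\<Union>i\<in>I. edges (Hs ! i))" using i by blast
  qed (auto simp: I_def)
  moreover have "I \<subseteq> {..<length Hs}" by (auto simp: I_def)
  ultimately show ?thesis using Hs unfolding join_biseparation_def by blast
qed

lemma plane_iff: "ribbon_graph G \<Longrightarrow> plane G \<longleftrightarrow> rg_connected G \<and> dual_genus G {} = 0"
  and RP2_iff: "ribbon_graph G \<Longrightarrow> RP2 G \<longleftrightarrow> rg_connected G \<and> dual_genus G {} = 1"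
  using euler_genus_connected by (fastforce simp: plane_def RP2_def)+

text \<open>By integrality a nonzero summand is at least 1 and so exhausts the sum.\<close>

lemma sum_nonneg_eq_1:
  fixes f :: "nat \<Rightarrow> int"
  assumes "\<And>i. i < n \<Longrightarrow> f i \<ge> 0" "(\<Sum>i<n. f i) = 1"
  shows "\<exists>i<n. f i = 1 \<and> (\<forall>j<n. j \<noteq> i \<longrightarrow> f j = 0)"
proof -
  have "\<exists>i<n. f i \<noteq> 0"
  proof (rule ccontr)
    assume "\<not> ?thesis"
    then have "(\<Sum>i<n. f i) = 0" by simp
    then show False using assms(2) by simp
  qed
  then obtain i where i: "i < n" "f i \<noteq> 0" by blast
  then have s: "f i + (\<Sum>j\<in>{..<n} - {i}. f j) = 1" using assms(2) by (simp add: sum.remove)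
  have ge: "(\<Sum>j\<in>{..<n} - {i}. f j) \<ge> 0" using assms(1) by (intro sum_nonneg) auto
  have "f i \<ge> 1" using i assms(1)[of i] by simp
  then have "f i = 1" "(\<Sum>j\<in>{..<n} - {i}. f j) = 0" using s ge by linarith+
  then have "\<forall>j\<in>{..<n} - {i}. f j = 0"
    using assms(1) sum_nonneg_eq_0_iff[of "{..<n} - {i}" f] by auto
  then show ?thesis using i \<open>f i = 1\<close> by auto
qed

theorem theorem4:
  fixes G :: "('v, 'e, 'p) ribbon_graph" and A :: "'e set"
  assumes "ribbon_graph G" and "rg_connected G" and "A \<subseteq> edges G"
  shows "(plane G \<and> plane (partial_dual G A) \<longleftrightarrow> plane_join_biseparation G A) \<and>
         (RP2 G \<and> RP2 (partial_dual G A) \<longleftrightarrow> RP2_join_biseparation G A)"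
proof -
  note G = assms(1) and con = assms(2)
  have pl: "plane G \<and> plane (partial_dual G A) \<longleftrightarrow> dual_genus G {} = 0 \<and> dual_genus G A = 0"
    and rp: "RP2 G \<and> RP2 (partial_dual G A) \<longleftrightarrow> dual_genus G {} = 1 \<and> dual_genus G A = 1"
    using con connected_partial_dual[OF G con]
    by (simp_all add: plane_iff RP2_iff G ribbon_partial_dual dual_genus_partial_dual)
  \<comment> \<open>Both Euler genera are the same sum of nonnegative integers: it is 0 iff all
    parts are plane, and 1 iff exactly one part has Euler genus 1 and the others are plane.\<close>
  have sums: "dual_genus G A = (\<Sum>i<length Hs. dual_genus (Hs ! i) {})"
    "dual_genus G {} = (\<Sum>i<length Hs. dual_genus (Hs ! i) {})"
    and parts: "\<And>i. i < length Hs \<Longrightarrow> (plane (Hs ! i) \<longleftrightarrow> dual_genus (Hs ! i) {} = 0) \<and>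
      (RP2 (Hs ! i) \<longleftrightarrow> dual_genus (Hs ! i) {} = 1) \<and> dual_genus (Hs ! i) {} \<ge> 0"
    if "join_biseparation G A Hs" for Hs
    using join_biseparation_dual_genus[OF G con that]
    by (simp_all add: plane_iff RP2_iff dual_genus_nonneg)
  note ex = exists_join_biseparation[OF G con assms(3)]
  show ?thesis unfolding pl rp
  proof (intro conjI iffI)
    assume "dual_genus G {} = 0 \<and> dual_genus G A = 0"
    then obtain Hs where Hs: "join_biseparation G A Hs" "(\<Sum>i<length Hs. dual_genus (Hs ! i) {}) = 0"
      using ex sums(2) by fastforce
    then have "\<forall>i<length Hs. dual_genus (Hs ! i) {} = 0"
      using parts[OF Hs(1)] by (subst (asm) sum_nonneg_eq_0_iff) auto
    then show "plane_join_biseparation G A"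
      using Hs(1) parts unfolding plane_join_biseparation_def by blast
  next
    assume "plane_join_biseparation G A"
    then obtain Hs where Hs: "join_biseparation G A Hs" "\<forall>i<length Hs. plane (Hs ! i)"
      by (auto simp: plane_join_biseparation_def)
    then have "(\<Sum>i<length Hs. dual_genus (Hs ! i) {}) = 0" using parts by (intro sum.neutral) auto
    then show "dual_genus G {} = 0" "dual_genus G A = 0" using sums[OF Hs(1)] by simp_all
  next
    assume "dual_genus G {} = 1 \<and> dual_genus G A = 1"
    then obtain Hs where Hs: "join_biseparation G A Hs" "(\<Sum>i<length Hs. dual_genus (Hs ! i) {}) = 1"
      using ex sums(2) by fastforce
    then obtain i where "i < length Hs" "dual_genus (Hs ! i) {} = 1"
      "\<forall>j<length Hs. j \<noteq> i \<longrightarrow> dual_genus (Hs ! j) {} = 0"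
      using sum_nonneg_eq_1[OF _ Hs(2)] parts[OF Hs(1)] by blast
    then have "i < length Hs \<and> RP2 (Hs ! i) \<and> (\<forall>j<length Hs. j \<noteq> i \<longrightarrow> plane (Hs ! j))"
      using parts[OF Hs(1)] by simp
    then show "RP2_join_biseparation G A" using Hs(1) unfolding RP2_join_biseparation_def by blast
  next
    assume "RP2_join_biseparation G A"
    then obtain Hs i where Hs: "join_biseparation G A Hs" "i < length Hs" "RP2 (Hs ! i)"
      "\<forall>j<length Hs. j \<noteq> i \<longrightarrow> plane (Hs ! j)"
      by (auto simp: RP2_join_biseparation_def)
    have "(\<Sum>j<length Hs. dual_genus (Hs ! j) {}) = (\<Sum>j<length Hs. if j = i then 1 else 0)"
      using parts[OF Hs(1)] Hs(2-4) by (intro sum.cong) auto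
    also have "\<dots> = 1" using Hs(2) by simp
    finally show "dual_genus G {} = 1" "dual_genus G A = 1" using sums[OF Hs(1)] by simp_all
  qed
qed

end
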